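(* Let $H \in \mathbb{R}^{2N\times 2N}$ be a real symmetric matrix and let $S_h \in \mathbb{C}^{2N\times 2N}$ be a family of complex symplectic matrices depending smoothly on $h\in \mathbb{R}$ such that (i) $\sigma(S_h) = \overline{\sigma(S_h)}$; (ii) there exists $p\geq 1$ such that $S_h = e^{hJH} + \mathcal{O}(h^{p+1})$ as $h\to 0$; (iii) there exist a real symplectic matrix $P \in \mathbb{R}^{2N \times 2N}$ and real frequencies $\omega=(\omega_1,\ldots,\omega_N)$ such that $H = P^T D_\omega P$; (iv) the numbers $\omega_1, \ldots, \omega_N, -\omega_1, \ldots, -\omega_N$ are all distinct. Then there exists a constant $C>0$ such that, provided that $|h|$ is small enough, for all $y = (q,p) \in \mathbb{R}^{2N}$: (a) the numerical solution remains globally bounded in time and its imaginary part remains small for all times: $$\sup_{n\in \mathbb{Z}} |S_h^n y| \leq C |y| \qquad \text{and} \qquad \sup_{n\in \mathbb{Z}} |\Im (S_h^n y)| \leq C |h|^p|y|;$$ (b) the actions and the Hamiltonian are almost preserved for all times: $$\sup_{n\in \mathbb{Z}} \sup_{1\leq j\leq N} |\mathcal{I}_j (S_h^n y) - \mathcal{I}_j (y)| \leq C |h|^p |y|^2 \qquad \text{and} \qquad \sup_{n\in \mathbb{Z}} |\mathcal{H} (S_h^n y) - \mathcal{H} (y)| \leq C|h|^p |y|^2.$$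
   Context: $J = \begin{pmatrix} O_N & I_N \\ -I_N & O_N\end{pmatrix}\in\mathbb{R}^{2N\times 2N}$. A real or complex $2N\times 2N$ matrix $S$ is symplectic if $S^T J S = J$ (transpose, no complex conjugation). For $\omega\in \mathbb{R}^N$, $D_\omega=\begin{pmatrix}\Delta_\omega & \\ & \Delta_\omega\end{pmatrix}$ with $\Delta_\omega=\mathrm{diag}(\omega_1,\ldots,\omega_N)$. $\sigma(A)$ is the set of eigenvalues of $A$, and $\overline{X}=\{\overline z: z\in X\}$ for $X\subset\mathbb{C}$. The Hamiltonian is $\mathcal{H}(y)=\frac12 y^T H y$ and the actions are $\mathcal{I}_j(y)=\mathcal{J}_j(Py)$, where $\mathcal{J}_j(q,p)=\frac12(p_j^2+q_j^2)$ for $(q,p)$ with $q,p$ the first and last $N$ coordinates; these quadratic polynomial formulas (without complex conjugation) also define $\mathcal{H}$ and $\mathcal{I}_j$ at complex vectors such as $S_h^n y\in\mathbb{C}^{2N}$. $|\cdot|$ is the Euclidean norm on vectors (modulus on scalars), and $\Im$ is the componentwise imaginary part. The constant $C$ does not depend on $h$, $y$ or $n$. The exponent $p$ in $|h|^p$ is the integer consistency order of (ii), not the momentum variable. $N \ge 1$ is an integer. *)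

theory Defs
  imports "HOL-Analysis.Analysis" "HOL-Library.Landau_Symbols"
begin

(* Vectors with 2N entries are indexed by 'n + 'n with N = CARD('n): the components Inl j are the
   positions q_j, the components Inr j the momenta p_j. *)

definition block_mat ::
  "'a^'n^'n \<Rightarrow> 'a^'n^'n \<Rightarrow> 'a^'n^'n \<Rightarrow> 'a^'n^'n \<Rightarrow> 'a^('n + 'n)^('n::finite + 'n)" where
  "block_mat A B C D =
     (\<chi> i j. case i of
        Inl a \<Rightarrow> (case j of Inl b \<Rightarrow> A $ a $ b | Inr b \<Rightarrow> B $ a $ b)
      | Inr a \<Rightarrow> (case j of Inl b \<Rightarrow> C $ a $ b | Inr b \<Rightarrow> D $ a $ b))"

definition J_mat :: "'a::comm_ring_1^('n + 'n)^('n::finite + 'n)" where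
  "J_mat = block_mat 0 (mat 1) (- mat 1) 0"

definition symplectic :: "'a::comm_ring_1^('n + 'n)^('n::finite + 'n) \<Rightarrow> bool" where
  "symplectic S \<longleftrightarrow> transpose S ** J_mat ** S = J_mat"

definition diag_mat :: "'a::zero^'n \<Rightarrow> 'a^'n^'n::finite" where
  "diag_mat w = (\<chi> i j. if i = j then w $ i else 0)"

definition D_mat :: "real^'n \<Rightarrow> real^('n + 'n)^('n::finite + 'n)" where
  "D_mat w = block_mat (diag_mat w) 0 0 (diag_mat w)"

(* The operations * and ^ on the type vec, where available, are componentwise,
   hence a separate notion of matrix power. *)
primrec mat_pow :: "'a::semiring_1^'m^'m \<Rightarrow> nat \<Rightarrow> 'a^'m^'m" where
  "mat_pow A 0 = mat 1"
| "mat_pow A (Suc k) = A ** mat_pow A k"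

definition mat_powi :: "'a::semiring_1^'m^'m \<Rightarrow> int \<Rightarrow> 'a^'m^'m" where
  "mat_powi A n =
     (if 0 \<le> n then mat_pow A (nat n) else mat_pow (matrix_inv A) (nat (- n)))"

definition mat_exp :: "real^'m^'m \<Rightarrow> real^'m^'m" where
  "mat_exp A = (\<Sum>k. (1 / fact k) *\<^sub>R mat_pow A k)"

definition spectrum :: "complex^'m^'m \<Rightarrow> complex set" where
  "spectrum A = {z. \<exists>v. v \<noteq> 0 \<and> A *v v = z *s v}"

definition cvec :: "real^'m \<Rightarrow> complex^'m" where
  "cvec v = (\<chi> i. complex_of_real (v $ i))"

definition cmat :: "real^'m^'k \<Rightarrow> complex^'m^'k" where
  "cmat A = (\<chi> i j. complex_of_real (A $ i $ j))"

definition Im_vec :: "complex^'m \<Rightarrow> real^'m" where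
  "Im_vec v = (\<chi> i. Im (v $ i))"

(* C-infinity on the whole real line: D k is the k-th derivative of f. *)
definition smooth :: "(real \<Rightarrow> 'a::real_normed_vector) \<Rightarrow> bool" where
  "smooth f \<longleftrightarrow>
     (\<exists>D :: nat \<Rightarrow> real \<Rightarrow> 'a. D 0 = f \<and>
        (\<forall>k h. (D k has_vector_derivative D (Suc k) h) (at h)))"

(* The quadratic polynomials y^T H y / 2 and (p_j^2 + q_j^2) / 2 at complex vectors,
   without complex conjugation. *)
definition hamiltonian :: "real^'m^'m \<Rightarrow> complex^'m \<Rightarrow> complex" where
  "hamiltonian H y = (1 / 2) * (\<Sum>i\<in>UNIV. y $ i * (cmat H *v y) $ i)"

definition J_action :: "'n \<Rightarrow> complex^('n::finite + 'n) \<Rightarrow> complex" where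
  "J_action j y = (1 / 2) * ((y $ Inr j)\<^sup>2 + (y $ Inl j)\<^sup>2)"

definition I_action :: "real^('n + 'n)^('n + 'n) \<Rightarrow> 'n \<Rightarrow> complex^('n::finite + 'n) \<Rightarrow> complex" where
  "I_action P j y = J_action j (cmat P *v y)"

end

theory Submission
  imports Defs
begin

text \<open>
  After the symplectic change of coordinates \<open>P\<close>, the exact flow consists of
  rotations in the \<open>N\<close> planes \<open>(q\<^sub>j, p\<^sub>j)\<close>, so \<open>J H\<close> is diagonalisable with the distinct eigenvalues
  \<open>\<plusminus> \<i> \<omega>\<^sub>j\<close>, and the eigenvalues of \<open>exp (h J H)\<close> have mutual distance of order \<open>|h|\<close>
  (\<open>exp_scaled_gap\<close>). The numerical map \<open>S h\<close> differs from the exponential by a term of size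
  \<open>|h|\<^bsup>p+1\<^esup>\<close>. Dividing by the gap, perturbation theory gives an eigenbasis of \<open>S h\<close> at distance of order
  \<open>|h|\<^sup>p\<close> from that of \<open>J H\<close> (\<open>perturbed_eigenbasis\<close>, by Brouwer's fixed point theorem).

  The spectrum of \<open>S h\<close> is invariant under conjugation and, by symplecticity, under inversion. Each of its points
  is the only one near an eigenvalue of the exponential, and the reflection \<open>z \<mapsto> 1 / cnj z\<close> fixes the
  unit circle pointwise, so no eigenvalue can leave the circle and conjugate eigenvalues stay conjugate
  (\<open>symplectic_eigenvalues_unimodular\<close>). The powers of the eigenvalues are thus bounded for all exponents, positive
  or negative, and replacing the perturbed eigenbasis by the exact one changes \<open>(S h)\<^sup>n\<close> by a term of order
  \<open>|h|\<^sup>p\<close>, uniformly in \<open>n\<close> (\<open>symplectic_powers_near_diagonal\<close>). What remains is real: in the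
  coordinates \<open>P y\<close> it is a rotation in every plane (\<open>powers_near_plane_rotations\<close>). Such a map is bounded and
  preserves all actions, hence also the Hamiltonian, which is their combination with
  coefficients \<open>\<omega>\<^sub>j\<close>. The theorem follows by adding the uniformly small error
  (\<open>bounds_near_plane_rotations\<close>).
\<close>

section \<open>Norm estimates for matrices\<close>

lemma matrix_add_rdistrib: "(A + B) ** C = A ** C + B ** C"
  for A B :: "'a::semiring_1^'n^'m"
  by (vector matrix_matrix_mult_def sum.distrib distrib_right)

lemma matrix_diff_rdistrib: "(A - B) ** C = A ** C - B ** C"
  for A B :: "'a::ring_1^'n^'m"
  by (vector matrix_matrix_mult_def sum_subtractf left_diff_distrib)

lemma matrix_diff_ldistrib: "A ** (B - C) = A ** B - A ** C"
  for A :: "'a::ring_1^'n^'m"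
  by (vector matrix_matrix_mult_def sum_subtractf right_diff_distrib)

lemma norm_vec_le_sum: "norm x \<le> (\<Sum>i\<in>UNIV. norm (x $ i))"
  by (simp add: norm_vec_def L2_set_le_sum)

lemma norm_axis_one: "norm (axis k 1 :: 'a::real_normed_algebra_1^'n) = 1"
proof (rule antisym)
  have "norm (axis k 1 :: 'a^'n) \<le> (\<Sum>i\<in>UNIV. norm ((axis k 1 :: 'a^'n) $ i))"
    by (rule norm_vec_le_sum)
  also have "\<dots> = (\<Sum>i\<in>UNIV. if i = k then 1 else 0)"
    by (rule sum.cong) (auto simp: axis_def)
  finally show "norm (axis k 1 :: 'a^'n) \<le> 1" by simp
  show "1 \<le> norm (axis k 1 :: 'a^'n)"
    using Finite_Cartesian_Product.norm_nth_le[of "axis k 1 :: 'a^'n" k] by simp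
qed

lemma norm_matrix_vector_mult_le: "norm (A *v x) \<le> norm A * norm x"
  for A :: "'a::real_normed_algebra_1^'n^'m"
proof -
  have row: "norm ((A *v x) $ i) \<le> norm (A $ i) * norm x" for i
  proof -
    have "norm ((A *v x) $ i) \<le> (\<Sum>j\<in>UNIV. norm (A $ i $ j * x $ j))"
      by (simp add: matrix_vector_mult_def norm_sum)
    also have "\<dots> \<le> (\<Sum>j\<in>UNIV. norm (A $ i $ j) * norm (x $ j))"
      by (intro sum_mono norm_mult_ineq)
    also have "\<dots> \<le> norm (A $ i) * norm x"
      using L2_set_mult_ineq[of "\<lambda>j. norm (A $ i $ j)" "\<lambda>j. norm (x $ j)" UNIV]
      by (simp add: norm_vec_def)
    finally show ?thesis .
  qed
  have "norm (A *v x) \<le> L2_set (\<lambda>i. norm (A $ i) * norm x) UNIV"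
    unfolding norm_vec_def[of "A *v x"] by (rule L2_set_mono) (simp_all add: row)
  also have "\<dots> = norm A * norm x"
    by (simp add: norm_vec_def[of A] L2_set_left_distrib)
  finally show ?thesis .
qed

lemma norm_transpose: "norm (transpose A) = norm A"
  for A :: "'a::real_normed_vector^'n^'m"
proof -
  have "(\<Sum>i\<in>UNIV. \<Sum>j\<in>UNIV. (norm (A $ j $ i))\<^sup>2) = (\<Sum>i\<in>UNIV. \<Sum>j\<in>UNIV. (norm (A $ i $ j))\<^sup>2)"
    by (rule sum.swap)
  then show ?thesis
    by (simp add: norm_vec_def L2_set_def transpose_def sum_nonneg)
qed

lemma norm_matrix_mult_le: "norm (A ** B) \<le> norm A * norm B"
  for A :: "'a::real_normed_field^'n^'m"
proof -
  have row: "(A ** B) $ i = transpose B *v (A $ i)" for i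
    by (simp add: vec_eq_iff matrix_matrix_mult_def matrix_vector_mult_def transpose_def mult.commute)
  have "norm (A ** B) \<le> L2_set (\<lambda>i. norm (A $ i) * norm B) UNIV"
    unfolding norm_vec_def[of "A ** B"]
  proof (rule L2_set_mono)
    show "norm ((A ** B) $ i) \<le> norm (A $ i) * norm B" for i
      unfolding row
      using norm_matrix_vector_mult_le[of "transpose B" "A $ i"]
      by (simp only: norm_transpose mult.commute)
  qed simp
  also have "\<dots> = norm A * norm B"
    by (simp add: norm_vec_def[of A] L2_set_left_distrib)
  finally show ?thesis .
qed

lemma norm_matrix_mult3_le: "norm (A ** B ** C) \<le> norm A * norm B * norm C"
  for A :: "'a::real_normed_field^'n^'m"
  using norm_matrix_mult_le[of "A ** B" C]
    mult_right_mono[OF norm_matrix_mult_le[of A B] norm_ge_zero[of C]] by linarith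

lemma matrix_mult_diag_mat: "(A ** diag_mat d) $ i $ j = A $ i $ j * d $ j"
  for A :: "'a::semiring_1^'n^'m"
  by (simp add: matrix_matrix_mult_def diag_mat_def if_distrib[of "\<lambda>x. _ * x"] cong: if_cong)

lemma diag_mat_mult_vector: "(diag_mat d *v x) $ i = d $ i * x $ i"
  for d :: "'a::semiring_1^'n"
  by (simp add: matrix_vector_mult_def diag_mat_def if_distrib[of "\<lambda>x. x * _"] cong: if_cong)

lemma norm_diag_mat_le: "norm (diag_mat d) \<le> (\<Sum>k\<in>UNIV. norm (d $ k))"
  for d :: "'a::{real_normed_vector}^'n"
proof -
  have "norm (diag_mat d $ i) \<le> norm (d $ i)" for i
  proof -
    have "norm (diag_mat d $ i) \<le> (\<Sum>j\<in>UNIV. norm (diag_mat d $ i $ j))"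
      by (rule norm_vec_le_sum)
    also have "\<dots> = (\<Sum>j\<in>UNIV. if i = j then norm (d $ i) else 0)"
      by (rule sum.cong) (auto simp: diag_mat_def)
    finally show ?thesis by simp
  qed
  then show ?thesis
    by (rule order_trans[OF norm_vec_le_sum sum_mono])
qed

lemma norm_mat_one_le: "norm (mat 1 :: 'a::real_normed_algebra_1^'n^'n) \<le> CARD('n)"
proof -
  have "mat 1 = (diag_mat (\<chi> i. 1) :: 'a^'n^'n)"
    by (simp add: mat_def diag_mat_def vec_eq_iff)
  then show ?thesis
    using norm_diag_mat_le[of "(\<chi> i. 1) :: 'a^'n"] by simp
qed

text \<open>
  The bound on the inverse \<open>X\<close> comes from \<open>X = 1 - X W\<close>: the term \<open>X W\<close> costs at most half of
  \<open>norm X\<close> and can be absorbed.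
\<close>

lemma inverse_one_plus_small:
  fixes W :: "'a::real_normed_field^'n^'n"
  assumes "norm W \<le> 1/2"
  obtains X where "(mat 1 + W) ** X = mat 1" "X ** (mat 1 + W) = mat 1" "norm X \<le> 2 * CARD('n)"
proof -
  have "x = 0" if "(mat 1 + W) *v x = 0" for x
  proof -
    have "x = - (W *v x)"
      using that by (simp add: matrix_vector_mult_add_rdistrib add_eq_0_iff)
    then have "norm x \<le> norm W * norm x"
      using norm_matrix_vector_mult_le[of W x] by (metis norm_minus_cancel)
    also have "\<dots> \<le> 1/2 * norm x"
      using assms by (intro mult_right_mono) auto
    finally show "x = 0" by simp
  qed
  then have "\<exists>X. X ** (mat 1 + W) = mat 1"
    by (subst matrix_left_invertible_ker) simp
  then obtain X where X: "X ** (mat 1 + W) = mat 1" ..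
  then have "X = mat 1 - X ** W"
    by (simp add: matrix_add_ldistrib eq_diff_eq)
  then have "norm X \<le> norm (mat 1 :: 'a^'n^'n) + norm (X ** W)"
    by (metis norm_triangle_ineq4)
  also have "norm (X ** W) \<le> norm X * (1/2)"
    using norm_matrix_mult_le[of X W] mult_left_mono[OF assms norm_ge_zero[of X]] by linarith
  finally have "norm X \<le> 2 * CARD('n)"
    using norm_mat_one_le[where 'a='a and 'n='n] by linarith
  with X show thesis
    using that[of X] matrix_left_right_inverse[of X "mat 1 + W"] by simp
qed

section \<open>Eigenvectors of a perturbed diagonal matrix\<close>

text \<open>
  A diagonal matrix with a spectral gap \<open>g\<close> keeps an eigenvector near each coordinate vector \<open>e\<^sub>k\<close>
  under a perturbation that is small compared with \<open>g\<close>. Write the eigenvector as \<open>v = e\<^sub>k + w\<close> with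
  \<open>w\<^sub>k = 0\<close>. Row \<open>k\<close> of the eigenvalue equation says that the eigenvalue is \<open>d\<^sub>k + (E v)\<^sub>k\<close>, and then row
  \<open>l \<noteq> k\<close> says \<open>w\<^sub>l = (E v)\<^sub>l / (d\<^sub>k + (E v)\<^sub>k - d\<^sub>l)\<close>. On the ball of radius \<open>4 m |E| / g \<le> 1\<close>, where
  \<open>m\<close> is the dimension, the numerators are at most \<open>2 |E|\<close> and the denominators at least \<open>g / 2\<close>, so the
  right-hand side maps the ball into itself, and Brouwer's theorem provides a solution.
\<close>

lemma perturbed_eigenvector:
  fixes d :: "complex^'m" and E :: "complex^'m^'m"
  assumes gap: "\<And>l. l \<noteq> k \<Longrightarrow> g \<le> cmod (d $ k - d $ l)"
    and "0 < g" and small: "4 * real CARD('m) * norm E \<le> g"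
  obtains w z where "norm w \<le> 4 * real CARD('m) * norm E / g"
    and "(diag_mat d + E) *v (axis k 1 + w) = z *s (axis k 1 + w)"
    and "cmod (z - d $ k) \<le> 2 * norm E"
proof -
  define r where "r = 4 * real CARD('m) * norm E / g"
  have r: "0 \<le> r" "r \<le> 1"
    using small \<open>0 < g\<close> by (simp_all add: r_def)
  have card1: "1 \<le> real CARD('m)"
    by (simp add: Suc_leI)
  then have "1 * norm E \<le> real CARD('m) * norm E"
    by (intro mult_right_mono) auto
  with small have small': "4 * norm E \<le> g"
    by linarith
  define v :: "complex^'m \<Rightarrow> complex^'m" where "v w = axis k 1 + w" for w
  define F :: "complex^'m \<Rightarrow> complex^'m" where
    "F w = (\<chi> l. if l = k then 0 else (E *v v w) $ l / (d $ k + (E *v v w) $ k - d $ l))" for w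
  have Ev: "cmod ((E *v v w) $ i) \<le> 2 * norm E" if "w \<in> cball 0 r" for w i
  proof -
    have "norm (v w) \<le> 2"
      using that r norm_triangle_ineq[of "axis k 1" w] by (simp add: v_def norm_axis_one)
    then have "norm E * norm (v w) \<le> norm E * 2"
      by (intro mult_left_mono) auto
    then show ?thesis
      using norm_matrix_vector_mult_le[of E "v w"] Finite_Cartesian_Product.norm_nth_le[of "E *v v w" i] by linarith
  qed
  have den: "g / 2 \<le> cmod (d $ k + (E *v v w) $ k - d $ l)" if "w \<in> cball 0 r" "l \<noteq> k" for w l
  proof -
    have "cmod (d $ k - d $ l) \<le> cmod (d $ k + (E *v v w) $ k - d $ l) + cmod ((E *v v w) $ k)"
      using norm_triangle_ineq4[of "d $ k + (E *v v w) $ k - d $ l" "(E *v v w) $ k"] by simp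
    then show ?thesis
      using gap[OF that(2)] Ev[OF that(1), of k] small' by linarith
  qed
  have cont: "continuous_on (cball 0 r) F"
    unfolding F_def v_def matrix_vector_mult_def
  proof (intro continuous_on_vec_lambda)
    fix l
    show "continuous_on (cball 0 r) (\<lambda>w. if l = k then 0 else
       (\<chi> i. \<Sum>j\<in>UNIV. E $ i $ j * (axis k 1 + w) $ j) $ l /
       (d $ k + (\<chi> i. \<Sum>j\<in>UNIV. E $ i $ j * (axis k 1 + w) $ j) $ k - d $ l))"
    proof (cases "l = k")
      case False
      have "d $ k + (\<chi> i. \<Sum>j\<in>UNIV. E $ i $ j * (axis k 1 + w) $ j) $ k - d $ l \<noteq> 0"
        if "w \<in> cball 0 r" for w
        using den[OF that False] \<open>0 < g\<close> unfolding v_def matrix_vector_mult_def by auto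
      with False show ?thesis
        by (simp, intro continuous_intros ballI) auto
    qed simp
  qed
  have maps: "F \<in> cball 0 r \<rightarrow> cball 0 r"
  proof
    fix w :: "complex^'m" assume w: "w \<in> cball 0 r"
    have "norm (F w $ l) \<le> 4 * norm E / g" for l
    proof (cases "l = k")
      case True
      then show ?thesis using \<open>0 < g\<close> by (simp add: F_def)
    next
      case False
      have "norm (F w $ l) \<le> (2 * norm E) / (g / 2)"
        using False frac_le[OF _ Ev[OF w, of l] _ den[OF w False]] \<open>0 < g\<close>
        by (simp add: F_def norm_divide)
      then show ?thesis by (simp add: field_simps)
    qed
    then have "norm (F w) \<le> (\<Sum>l\<in>(UNIV::'m set). 4 * norm E / g)"
      by (rule order_trans[OF norm_vec_le_sum sum_mono])
    then show "F w \<in> cball 0 r"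
      by (simp add: r_def field_simps)
  qed
  have "cball (0 :: complex^'m) r \<noteq> {}"
    using r by simp
  then obtain w where w: "w \<in> cball 0 r" "F w = w"
    by (rule brouwer[OF compact_cball convex_cball _ cont maps])
  define z where "z = d $ k + (E *v v w) $ k"
  have "((diag_mat d + E) *v v w) $ l = (z *s v w) $ l" for l
  proof (cases "l = k")
    case True
    have "w $ k = 0"
      by (subst w(2)[symmetric]) (simp add: F_def)
    with True show ?thesis
      by (simp add: matrix_vector_mult_add_rdistrib diag_mat_mult_vector z_def v_def)
  next
    case False
    have "w $ l = (E *v v w) $ l / (z - d $ l)"
      using arg_cong[OF w(2), of "\<lambda>w. w $ l"] False by (simp add: F_def z_def)
    moreover have "z - d $ l \<noteq> 0"
      using den[OF w(1) False] \<open>0 < g\<close> by (auto simp: z_def)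
    ultimately have "d $ l * w $ l + (E *v v w) $ l = z * w $ l"
      by (simp add: field_simps)
    moreover have "v w $ l = w $ l"
      using False by (simp add: v_def axis_def)
    ultimately show ?thesis
      by (simp add: matrix_vector_mult_add_rdistrib diag_mat_mult_vector)
  qed
  then have "(diag_mat d + E) *v v w = z *s v w"
    by (simp add: vec_eq_iff)
  with w Ev[OF w(1), of k] show thesis
    by (intro that[of w z]) (auto simp: r_def v_def z_def)
qed

lemma perturbed_eigenbasis:
  fixes d :: "complex^'m" and E :: "complex^'m^'m"
  assumes gap: "\<And>k l. k \<noteq> l \<Longrightarrow> g \<le> cmod (d $ k - d $ l)"
    and "0 < g" and small: "4 * real CARD('m) * norm E \<le> g"
  obtains W \<mu> where "(diag_mat d + E) ** (mat 1 + W) = (mat 1 + W) ** diag_mat \<mu>"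
    and "norm W \<le> 4 * (real CARD('m))\<^sup>2 * norm E / g"
    and "\<And>k. cmod (\<mu> $ k - d $ k) \<le> 2 * norm E"
proof -
  have "\<exists>w z. norm w \<le> 4 * real CARD('m) * norm E / g \<and>
      (diag_mat d + E) *v (axis k 1 + w) = z *s (axis k 1 + w) \<and> cmod (z - d $ k) \<le> 2 * norm E" for k
    using perturbed_eigenvector[of k g d E] gap assms(2) small by metis
  then obtain w z where w: "\<And>k. norm (w k) \<le> 4 * real CARD('m) * norm E / g"
    and eig: "\<And>k. (diag_mat d + E) *v (axis k 1 + w k) = z k *s (axis k 1 + w k)"
    and z: "\<And>k. cmod (z k - d $ k) \<le> 2 * norm E"
    by metis
  define W where "W = (\<chi> i j. w j $ i)"
  have col: "(mat 1 + W) $ i $ j = (axis j 1 + w j) $ i" for i j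
    by (simp add: W_def mat_def axis_def)
  have "((diag_mat d + E) ** (mat 1 + W)) $ i $ j = ((mat 1 + W) ** diag_mat (\<chi> k. z k)) $ i $ j" for i j
  proof -
    have "((diag_mat d + E) ** (mat 1 + W)) $ i $ j = ((diag_mat d + E) *v (axis j 1 + w j)) $ i"
      unfolding matrix_matrix_mult_def matrix_vector_mult_def by (simp only: vec_lambda_beta col)
    then show ?thesis
      unfolding matrix_mult_diag_mat col eig by (simp add: algebra_simps)
  qed
  then have 1: "(diag_mat d + E) ** (mat 1 + W) = (mat 1 + W) ** diag_mat (\<chi> k. z k)"
    by (simp add: vec_eq_iff)
  have "transpose W = (\<chi> j. w j)"
    by (simp add: W_def transpose_def vec_eq_iff)
  then have "norm W = norm (\<chi> j. w j)"
    by (metis norm_transpose)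
  also have "\<dots> \<le> (\<Sum>j\<in>UNIV. norm (w j))"
    using norm_vec_le_sum[of "\<chi> j. w j"] by simp
  also have "\<dots> \<le> (\<Sum>j\<in>(UNIV::'m set). 4 * real CARD('m) * norm E / g)"
    by (intro sum_mono w)
  also have "\<dots> = 4 * (real CARD('m))\<^sup>2 * norm E / g"
    by (simp add: power2_eq_square)
  finally show thesis
    using 1 z by (intro that[of W "\<chi> k. z k"]) auto
qed

section \<open>Spectrum and powers of diagonalised matrices\<close>

lemma spectrum_diagonalised:
  fixes A V U :: "complex^'m^'m"
  assumes AV: "A ** V = V ** diag_mat \<mu>" and VU: "V ** U = mat 1"
  shows "spectrum A = range (($) \<mu>)"
proof -
  have UV: "U ** V = mat 1"
    using VU matrix_left_right_inverse by blast
  have UA: "U ** A = diag_mat \<mu> ** U"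
    by (metis AV VU UV matrix_mul_assoc matrix_mul_lid matrix_mul_rid)
  show ?thesis
  proof (intro equalityI subsetI)
    fix z assume "z \<in> spectrum A"
    then obtain v where v: "v \<noteq> 0" "A *v v = z *s v"
      by (auto simp: spectrum_def)
    have "U *v v \<noteq> 0"
      by (metis v(1) VU matrix_vector_mul_assoc matrix_vector_mul_lid matrix_vector_mult_0_right)
    then obtain i where i: "(U *v v) $ i \<noteq> 0"
      by (auto simp: vec_eq_iff)
    have "diag_mat \<mu> *v (U *v v) = z *s (U *v v)"
      by (metis UA matrix_vector_mul_assoc v(2) vector_scalar_commute)
    then have "\<mu> $ i * (U *v v) $ i = z * (U *v v) $ i"
      by (metis diag_mat_mult_vector vector_smult_component)
    with i show "z \<in> range (($) \<mu>)" by auto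
  next
    fix z assume "z \<in> range (($) \<mu>)"
    then obtain k where k: "z = \<mu> $ k" by auto
    have "diag_mat \<mu> *v axis k 1 = z *s axis k 1"
      by (simp add: vec_eq_iff diag_mat_mult_vector k axis_def)
    then have "A *v (V *v axis k 1) = z *s (V *v axis k 1)"
      by (metis AV matrix_vector_mul_assoc vector_scalar_commute)
    moreover have "V *v axis k 1 \<noteq> 0"
      by (metis UV axis_eq_0_iff matrix_vector_mul_assoc matrix_vector_mul_lid
          matrix_vector_mult_0_right zero_neq_one)
    ultimately show "z \<in> spectrum A"
      by (auto simp: spectrum_def)
  qed
qed

text \<open>
  Inverting and transposing \<open>A V = V D\<close> exhibits the transpose of \<open>A\<close> as diagonalised with the same
  diagonal part, which avoids characteristic polynomials.
\<close>

lemma spectrum_transpose_diagonalised: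
  fixes A V U :: "complex^'m^'m"
  assumes AV: "A ** V = V ** diag_mat \<mu>" and VU: "V ** U = mat 1"
  shows "spectrum (transpose A) = range (($) \<mu>)"
proof -
  have UV: "U ** V = mat 1"
    using VU matrix_left_right_inverse by blast
  have UA: "U ** A = diag_mat \<mu> ** U"
    by (metis AV VU UV matrix_mul_assoc matrix_mul_lid matrix_mul_rid)
  have "transpose (diag_mat \<mu>) = diag_mat \<mu>"
    by (auto simp: vec_eq_iff transpose_def diag_mat_def)
  then have "transpose A ** transpose U = transpose U ** diag_mat \<mu>"
    by (metis UA matrix_transpose_mul)
  moreover have "transpose U ** transpose V = mat 1"
    by (metis VU matrix_transpose_mul transpose_mat)
  ultimately show ?thesis
    by (rule spectrum_diagonalised)
qed

lemma mat_pow_diagonalised: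
  fixes A V :: "'a::field^'m^'m"
  assumes "A ** V = V ** diag_mat \<mu>"
  shows "mat_pow A k ** V = V ** diag_mat (\<chi> i. \<mu> $ i ^ k)"
proof (induction k)
  case 0
  have "diag_mat (\<chi> i. \<mu> $ i ^ 0) = (mat 1 :: 'a^'m^'m)"
    by (simp add: diag_mat_def mat_def vec_eq_iff)
  then show ?case by simp
next
  case (Suc k)
  have "mat_pow A (Suc k) ** V = (A ** V) ** diag_mat (\<chi> i. \<mu> $ i ^ k)"
    by (simp add: Suc flip: matrix_mul_assoc)
  also have "\<dots> = V ** diag_mat (\<chi> i. \<mu> $ i ^ Suc k)"
    by (simp add: assms vec_eq_iff matrix_mult_diag_mat mult.assoc)
  finally show ?case .
qed

lemma matrix_inv_mult_left:
  "invertible A \<Longrightarrow> matrix_inv A ** A = mat 1"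
  unfolding matrix_inv_def invertible_def by (rule someI2_ex) auto

lemma mat_powi_diagonalised:
  fixes A V :: "'a::field^'m^'m"
  assumes AV: "A ** V = V ** diag_mat \<mu>" and inv: "invertible A" and nz: "\<And>i. \<mu> $ i \<noteq> 0"
  shows "mat_powi A n ** V = V ** diag_mat (\<chi> i. \<mu> $ i powi n)"
proof (cases "0 \<le> n")
  case True
  then show ?thesis
    using mat_pow_diagonalised[OF AV] by (simp add: mat_powi_def power_int_def)
next
  case False
  have "diag_mat \<mu> ** diag_mat (\<chi> i. inverse (\<mu> $ i)) = mat 1"
    using nz by (auto simp: vec_eq_iff matrix_mult_diag_mat) (auto simp: diag_mat_def mat_def)
  then have "V = A ** (V ** diag_mat (\<chi> i. inverse (\<mu> $ i)))"
    by (metis AV matrix_mul_assoc matrix_mul_rid)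
  then have "matrix_inv A ** V = V ** diag_mat (\<chi> i. inverse (\<mu> $ i))"
    by (metis inv matrix_inv_mult_left matrix_mul_assoc matrix_mul_lid)
  from mat_pow_diagonalised[OF this] False show ?thesis
    by (simp add: mat_powi_def power_int_def)
qed

section \<open>Symplectic matrices\<close>

lemma sum_UNIV_Plus: "(\<Sum>i\<in>UNIV. f i) = (\<Sum>a\<in>UNIV. f (Inl a)) + (\<Sum>b\<in>UNIV. f (Inr b))"
  for f :: "'a::finite + 'b::finite \<Rightarrow> 'c::comm_monoid_add"
  by (simp add: sum.Plus flip: UNIV_Plus_UNIV)

lemma block_mat_nth [simp]:
  "block_mat A B C D $ Inl a $ Inl b = A $ a $ b"
  "block_mat A B C D $ Inl a $ Inr b = B $ a $ b"
  "block_mat A B C D $ Inr a $ Inl b = C $ a $ b"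
  "block_mat A B C D $ Inr a $ Inr b = D $ a $ b"
  by (simp_all add: block_mat_def)

lemma J_mat_mult_nth [simp]:
  "(J_mat ** A) $ Inl a $ j = A $ Inr a $ j"
  "(J_mat ** A) $ Inr a $ j = - (A $ Inl a $ j)"
  for A :: "'a::comm_ring_1^'m^('n::finite + 'n)"
  by (simp_all add: matrix_matrix_mult_def J_mat_def sum_UNIV_Plus mat_def sum_negf
      if_distrib[of "\<lambda>x. x * _"] cong: if_cong)

lemma J_mat_mult_J_mat_mult: "J_mat ** (J_mat ** A) = - A"
  for A :: "'a::comm_ring_1^'m^('n::finite + 'n)"
  by (simp add: vec_eq_iff split_sum_all)

lemma matrix_minus_mult: "(- A) ** B = - (A ** B)" for A :: "'a::ring_1^'n^'m"
  by (vector matrix_matrix_mult_def sum_negf)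

lemma matrix_mult_minus: "A ** (- B) = - (A ** B)" for A :: "'a::ring_1^'n^'m"
  by (vector matrix_matrix_mult_def sum_negf)

lemma matrix_minus_mult_vector: "(- A) *v x = - (A *v x)" for A :: "'a::ring_1^'n^'m"
  by (vector matrix_vector_mult_def sum_negf)

lemma J_mat_mult_J_mat: "J_mat ** J_mat = - (mat 1 :: 'a::comm_ring_1^('n + 'n)^('n::finite + 'n))"
  using J_mat_mult_J_mat_mult[of "mat 1 :: 'a^('n + 'n)^('n + 'n)"] by simp

lemma symplectic_left_inverse:
  fixes S :: "'a::comm_ring_1^('n + 'n)^('n::finite + 'n)"
  assumes "symplectic S"
  shows "- (J_mat ** transpose S ** J_mat) ** S = mat 1"
proof -
  have "J_mat ** transpose S ** J_mat ** S = J_mat ** (transpose S ** J_mat ** S)"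
    by (simp add: matrix_mul_assoc)
  then show ?thesis
    using assms by (simp add: symplectic_def J_mat_mult_J_mat matrix_minus_mult)
qed

text \<open>
  If \<open>S v = z v\<close>, then \<open>J v = S\<^sup>T J S v = z S\<^sup>T (J v)\<close>: the vector \<open>J v\<close> is an eigenvector of the
  transpose.
\<close>

lemma symplectic_inverse_eigenvalue:
  fixes S :: "complex^('n + 'n)^('n::finite + 'n)"
  assumes "symplectic S" "z \<in> spectrum S"
  shows "inverse z \<in> spectrum (transpose S)"
proof -
  obtain v where v: "v \<noteq> 0" "S *v v = z *s v"
    using assms by (auto simp: spectrum_def)
  define w where "w = J_mat *v v"
  have "J_mat *v w = - v"
    by (simp add: w_def matrix_vector_mul_assoc J_mat_mult_J_mat
        matrix_minus_mult_vector)
  then have w: "w \<noteq> 0"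
    using v by auto
  have "w = transpose S *v (J_mat *v (S *v v))"
    using assms(1) by (simp add: w_def symplectic_def matrix_vector_mul_assoc matrix_mul_assoc)
  then have eq: "w = z *s (transpose S *v w)"
    by (simp only: v w_def vector_scalar_commute)
  then have "z \<noteq> 0"
    using w by auto
  with eq have "transpose S *v w = inverse z *s w"
    by (metis left_inverse vector_smult_assoc vector_smult_lid)
  with w show ?thesis
    by (auto simp: spectrum_def)
qed

text \<open>
  The spectrum is closed under conjugation by hypothesis and under inversion by symplecticity. Hence
  \<open>cnj \<mu>\<^sub>k\<close> and \<open>1 / cnj \<mu>\<^sub>k\<close> are eigenvalues too. Since the \<open>d\<^sub>k\<close> are unimodular, the former lies near
  \<open>cnj d\<^sub>k\<close>, the latter near \<open>d\<^sub>k\<close> itself. The gap between the \<open>d\<^sub>k\<close> leaves only one candidate for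
  each, and \<open>1 / cnj \<mu>\<^sub>k = \<mu>\<^sub>k\<close> means \<open>|\<mu>\<^sub>k| = 1\<close>.
\<close>

lemma symplectic_eigenvalues_unimodular:
  fixes S V U :: "complex^('n + 'n)^('n::finite + 'n)"
  assumes "symplectic S" and closed: "spectrum S = cnj ` spectrum S"
    and SV: "S ** V = V ** diag_mat \<mu>" and VU: "V ** U = mat 1"
    and near: "\<And>k. cmod (\<mu> $ k - d $ k) \<le> e" and "e \<le> 1/2" "3 * e < g"
    and gap: "\<And>k l. k \<noteq> l \<Longrightarrow> g \<le> cmod (d $ k - d $ l)"
    and d1: "\<And>k. cmod (d $ k) = 1" and conj: "\<And>k. d $ \<tau> k = cnj (d $ k)"
  shows "cmod (\<mu> $ k) = 1" and "\<mu> $ \<tau> k = cnj (\<mu> $ k)"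
proof -
  have spec: "spectrum S = range (($) \<mu>)" "spectrum (transpose S) = range (($) \<mu>)"
    using spectrum_diagonalised[OF SV VU] spectrum_transpose_diagonalised[OF SV VU] by auto
  have e: "0 \<le> e"
    using near[of undefined] norm_ge_zero order_trans by blast
  \<comment> \<open>An eigenvalue this close to one of the unperturbed values must be the corresponding perturbed one.\<close>
  have match: "z = \<mu> $ k" if zS: "z \<in> spectrum S" and zd: "cmod (z - d $ k) \<le> 2 * e" for z k
  proof -
    obtain l where l: "z = \<mu> $ l"
      using zS spec by auto
    have "cmod (d $ k - d $ l) \<le> cmod (z - d $ k) + cmod (z - d $ l)"
      using norm_triangle_ineq4[of "z - d $ l" "z - d $ k"] by simp
    then have "cmod (d $ k - d $ l) < g"
      using zd near[of l, folded l] \<open>3 * e < g\<close> by linarith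
    with gap[of k l] have "k = l" by linarith
    with l show ?thesis by simp
  qed
  have cnj_mem: "cnj (\<mu> $ k) \<in> spectrum S" for k
    by (subst closed) (auto simp: spec)
  have "cmod (cnj (\<mu> $ k) - d $ \<tau> k) \<le> 2 * e"
    using near[of k] e by (simp add: conj flip: complex_cnj_diff)
  with match cnj_mem show "\<mu> $ \<tau> k = cnj (\<mu> $ k)"
    by metis
  have half: "1/2 \<le> cmod (\<mu> $ k)"
    using near[of k] d1[of k] \<open>e \<le> 1/2\<close> norm_triangle_ineq2[of "d $ k" "\<mu> $ k"]
    by (simp add: norm_minus_commute)
  then have nz: "\<mu> $ k \<noteq> 0" "d $ k \<noteq> 0"
    using d1[of k] by auto
  have "cnj (d $ k) * d $ k = 1"
    using d1[of k] by (metis complex_norm_square mult.commute of_real_1 power_one)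
  then have "inverse (cnj (\<mu> $ k)) - d $ k = cnj (d $ k - \<mu> $ k) * d $ k / cnj (\<mu> $ k)"
    using nz by (simp add: field_simps)
  then have "cmod (inverse (cnj (\<mu> $ k)) - d $ k) = cmod (\<mu> $ k - d $ k) / cmod (\<mu> $ k)"
    using d1[of k] by (simp add: norm_divide norm_mult norm_minus_commute del: complex_cnj_diff)
  also have "\<dots> \<le> e / (1/2)"
    using near[of k] half e by (intro frac_le) auto
  finally have "cmod (inverse (cnj (\<mu> $ k)) - d $ k) \<le> 2 * e" by simp
  moreover have "inverse (cnj (\<mu> $ k)) \<in> spectrum S"
    using symplectic_inverse_eigenvalue[OF assms(1) cnj_mem] spec by simp
  ultimately have "inverse (cnj (\<mu> $ k)) = \<mu> $ k"
    by (intro match)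
  then have "\<mu> $ k * cnj (\<mu> $ k) = 1"
    using nz by (metis complex_cnj_zero_iff left_inverse)
  then have "(cmod (\<mu> $ k))\<^sup>2 = 1"
    by (metis complex_norm_square of_real_eq_1_iff of_real_power)
  then show "cmod (\<mu> $ k) = 1"
    using power2_eq_imp_eq[of "cmod (\<mu> $ k)" 1] by simp
qed

text \<open>
  The perturbed eigenbasis is \<open>V0 (1 + W)\<close> with \<open>W\<close> of size \<open>|E| / g\<close>. As all eigenvalues are unimodular,
  the diagonal matrix \<open>G\<close> of their powers is bounded for every exponent, and so is the commutator
  in \<open>(1 + W) G (1 + W)\<^sup>-\<^sup>1 - G = (W G - G W) (1 + W)\<^sup>-\<^sup>1\<close>. This is why the estimate does not grow with \<open>n\<close>.
\<close>

lemma symplectic_powers_near_diagonal: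
  fixes S V0 U0 E :: "complex^('n + 'n)^('n::finite + 'n)"
  defines "m \<equiv> real CARD('n + 'n)"
  assumes "symplectic S" and closed: "spectrum S = cnj ` spectrum S"
    and SV: "S ** V0 = V0 ** (diag_mat d + E)" and VU: "V0 ** U0 = mat 1"
    and gap: "\<And>k l. k \<noteq> l \<Longrightarrow> g \<le> cmod (d $ k - d $ l)" and "0 < g"
    and d1: "\<And>k. cmod (d $ k) = 1" and conj: "\<And>k. d $ \<tau> k = cnj (d $ k)"
    and small: "8 * m\<^sup>2 * norm E \<le> g" "norm E \<le> 1/4"
  obtains \<mu> where "\<And>k. cmod (\<mu> $ k) = 1" and "\<And>k. \<mu> $ \<tau> k = cnj (\<mu> $ k)"
    and "\<And>n. norm (mat_powi S n - V0 ** diag_mat (\<chi> k. \<mu> $ k powi n) ** U0)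
               \<le> norm V0 * norm U0 * (16 * m ^ 4 * (norm E / g))"
proof -
  have m: "1 \<le> m"
    unfolding m_def using zero_less_card_finite[where 'a="'n + 'n"] by linarith
  have "m * 1 \<le> m * m" "1 \<le> m * m"
    using m mult_mono[OF m m] by auto
  then have "m * norm E \<le> m\<^sup>2 * norm E" "1 * norm E \<le> m\<^sup>2 * norm E"
    unfolding power2_eq_square by (intro mult_right_mono norm_ge_zero; simp)+
  with small \<open>0 < g\<close> have small': "4 * m * norm E \<le> g" "3 * (2 * norm E) < g"
    using norm_ge_zero[of E] by linarith+
  obtain W \<mu> where DW: "(diag_mat d + E) ** (mat 1 + W) = (mat 1 + W) ** diag_mat \<mu>"
    and W: "norm W \<le> 4 * m\<^sup>2 * norm E / g"
    and near: "\<And>k. cmod (\<mu> $ k - d $ k) \<le> 2 * norm E"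
    using perturbed_eigenbasis[OF gap \<open>0 < g\<close> small'(1)[unfolded m_def]] unfolding m_def by blast
  have "4 * m\<^sup>2 * norm E / g \<le> 1/2"
    using small(1) \<open>0 < g\<close> by (simp add: field_simps)
  with W have "norm W \<le> 1/2" by linarith
  then obtain X where X: "(mat 1 + W) ** X = mat 1" "norm X \<le> 2 * m"
    using inverse_one_plus_small[of W] unfolding m_def by (metis of_nat_mult of_nat_numeral)
  define V where "V = V0 ** (mat 1 + W)"
  define U where "U = X ** U0"
  have "V ** U = V0 ** ((mat 1 + W) ** X) ** U0"
    by (simp add: V_def U_def matrix_mul_assoc)
  then have VU': "V ** U = mat 1"
    by (simp add: X VU)
  have "S ** V = V0 ** ((diag_mat d + E) ** (mat 1 + W))"
    by (simp add: V_def matrix_mul_assoc SV)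
  then have SV': "S ** V = V ** diag_mat \<mu>"
    by (simp add: V_def DW matrix_mul_assoc)
  note uni = symplectic_eigenvalues_unimodular[OF assms(2) closed SV' VU' near _ small'(2) gap d1 conj]
  have unimod: "cmod (\<mu> $ k) = 1" "\<mu> $ \<tau> k = cnj (\<mu> $ k)" for k
    using uni small(2) by auto
  have inv: "invertible S"
    using symplectic_left_inverse[OF assms(2)] invertible_left_inverse by blast
  have nz: "\<mu> $ k \<noteq> 0" for k
    using unimod(1)[of k] by auto
  show thesis
  proof (rule that[OF unimod])
    fix n
    define G where "G = diag_mat (\<chi> k. \<mu> $ k powi n)"
    have "norm G \<le> (\<Sum>k\<in>UNIV. norm ((\<chi> k. \<mu> $ k powi n) $ k))"
      unfolding G_def by (rule norm_diag_mat_le)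
    then have G: "norm G \<le> m"
      by (simp add: norm_power_int unimod m_def)
    have "mat_powi S n = mat_powi S n ** V ** U"
      by (metis VU' matrix_mul_assoc matrix_mul_rid)
    also have "\<dots> = V ** G ** U"
      by (simp only: mat_powi_diagonalised[OF SV' inv nz] G_def)
    also have "\<dots> = V0 ** ((mat 1 + W) ** G ** X) ** U0"
      by (simp add: V_def U_def matrix_mul_assoc)
    finally have "mat_powi S n - V0 ** G ** U0 = V0 ** ((mat 1 + W) ** G ** X - G) ** U0"
      by (simp add: matrix_diff_ldistrib matrix_diff_rdistrib)
    moreover have "(mat 1 + W) ** G ** X - G = (W ** G - G ** W) ** X"
    proof -
      have "G = G ** ((mat 1 + W) ** X)"
        by (simp add: X)
      then have "(mat 1 + W) ** G ** X - G = ((mat 1 + W) ** G - G ** (mat 1 + W)) ** X"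
        by (simp add: matrix_diff_rdistrib matrix_mul_assoc)
      also have "(mat 1 + W) ** G - G ** (mat 1 + W) = W ** G - G ** W"
        by (simp add: matrix_add_rdistrib matrix_add_ldistrib)
      finally show ?thesis .
    qed
    ultimately have "norm (mat_powi S n - V0 ** G ** U0) \<le> norm V0 * norm ((W ** G - G ** W) ** X) * norm U0"
      by (simp only: norm_matrix_mult3_le)
    also have "\<dots> \<le> norm V0 * (16 * m ^ 4 * (norm E / g)) * norm U0"
    proof (intro mult_left_mono mult_right_mono norm_ge_zero)
      have "norm W * norm G \<le> (4 * m\<^sup>2 * norm E / g) * m"
        using W G m \<open>0 < g\<close> by (intro mult_mono) auto
      moreover have "norm (W ** G - G ** W) \<le> norm W * norm G + norm G * norm W"
        using norm_triangle_ineq4[of "W ** G" "G ** W"] norm_matrix_mult_le[of W G]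
          norm_matrix_mult_le[of G W] by linarith
      moreover have "8 * m ^ 3 * (norm E / g) = 2 * ((4 * m\<^sup>2 * norm E / g) * m)"
        by (simp add: power2_eq_square power3_eq_cube)
      ultimately have "norm (W ** G - G ** W) \<le> 8 * m ^ 3 * (norm E / g)"
        by (simp only: mult.commute[of "norm G"])
      then have "norm (W ** G - G ** W) * norm X \<le> 8 * m ^ 3 * (norm E / g) * (2 * m)"
        using X(2) m \<open>0 < g\<close> by (intro mult_mono) auto
      also have "\<dots> = 16 * m ^ 4 * (norm E / g)"
        by (simp add: eval_nat_numeral)
      finally show "norm ((W ** G - G ** W) ** X) \<le> 16 * m ^ 4 * (norm E / g)"
        using norm_matrix_mult_le[of "W ** G - G ** W" X] by linarith
    qed
    finally show "norm (mat_powi S n - V0 ** diag_mat (\<chi> k. \<mu> $ k powi n) ** U0)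
               \<le> norm V0 * norm U0 * (16 * m ^ 4 * (norm E / g))"
      by (simp add: G_def mult_ac)
  qed
qed

section \<open>Real matrices over the complex numbers and the exponential\<close>

lemma cmat_nth [simp]: "cmat A $ i $ j = complex_of_real (A $ i $ j)"
  by (simp add: cmat_def)

lemma cvec_nth [simp]: "cvec v $ i = complex_of_real (v $ i)"
  by (simp add: cvec_def)

lemma cmat_mult: "cmat (A ** B) = cmat A ** cmat B"
  by (simp add: vec_eq_iff matrix_matrix_mult_def)

lemma cmat_mult_cvec: "cmat A *v cvec v = cvec (A *v v)"
  by (simp add: vec_eq_iff matrix_vector_mult_def)

lemma cmat_mat_one: "cmat (mat 1) = mat 1"
  by (simp add: vec_eq_iff mat_def)

lemma cmat_transpose: "cmat (transpose A) = transpose (cmat A)"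
  by (simp add: vec_eq_iff transpose_def)

lemma norm_cvec: "norm (cvec v) = norm v"
  by (simp add: norm_vec_def)

lemma norm_cmat: "norm (cmat A) = norm A"
  by (simp add: norm_vec_def)

lemma cmat_mat_pow: "cmat (mat_pow A k) = mat_pow (cmat A) k"
  by (induction k) (simp_all add: cmat_mat_one cmat_mult)

text \<open>
  Convergence of the exponential series is obtained entrywise: in the eigenbasis each entry is a fixed
  linear combination of scalar exponential series.
\<close>

lemma cmat_mat_exp_diagonalised:
  fixes V U :: "complex^'m^'m"
  assumes AV: "cmat A ** V = V ** diag_mat \<mu>" and VU: "V ** U = mat 1"
  shows "cmat (mat_exp A) = V ** diag_mat (\<chi> k. exp (\<mu> $ k)) ** U"
proof -
  define R where "R = V ** diag_mat (\<chi> k. exp (\<mu> $ k)) ** U"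
  define f where "f = (\<lambda>k. (1 / fact k) *\<^sub>R mat_pow A k)"
  have entry: "complex_of_real (f k $ i $ j)
      = (\<Sum>l\<in>UNIV. V $ i $ l * (\<mu> $ l ^ k /\<^sub>R fact k) * U $ l $ j)" for k i j
  proof -
    have "mat_pow (cmat A) k = mat_pow (cmat A) k ** V ** U"
      by (metis VU matrix_mul_assoc matrix_mul_rid)
    then have "cmat (mat_pow A k) = V ** diag_mat (\<chi> l. \<mu> $ l ^ k) ** U"
      by (simp add: mat_pow_diagonalised[OF AV] cmat_mat_pow)
    then have "complex_of_real (mat_pow A k $ i $ j) = (V ** diag_mat (\<chi> l. \<mu> $ l ^ k) ** U) $ i $ j"
      by (metis cmat_nth)
    also have "\<dots> = (\<Sum>l\<in>UNIV. V $ i $ l * \<mu> $ l ^ k * U $ l $ j)"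
      by (subst matrix_matrix_mult_def) (simp add: matrix_mult_diag_mat)
    finally have "complex_of_real (mat_pow A k $ i $ j) = \<dots>" .
    moreover have "complex_of_real (f k $ i $ j) = complex_of_real (mat_pow A k $ i $ j) / fact k"
      by (simp add: f_def)
    ultimately show ?thesis
      by (simp add: sum_distrib_left scaleR_conv_of_real divide_inverse mult_ac)
  qed
  have R: "R $ i $ j = (\<Sum>l\<in>UNIV. V $ i $ l * exp (\<mu> $ l) * U $ l $ j)" for i j
    unfolding R_def by (subst matrix_matrix_mult_def) (simp add: matrix_mult_diag_mat)
  have sums: "(\<lambda>k. complex_of_real (f k $ i $ j)) sums (R $ i $ j)" for i j
    unfolding entry R by (intro sums_sum sums_mult sums_mult2 exp_converges)
  define M where "M = (\<chi> i j. Re (R $ i $ j))"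
  have fM: "(\<lambda>k. f k $ i $ j) sums (M $ i $ j)" for i j
    using sums_Re[OF sums[of i j]] by (simp add: M_def)
  have "f sums M"
    unfolding sums_def by (intro vec_tendstoI) (use fM in \<open>simp add: sums_def\<close>)
  then have "mat_exp A = M"
    by (simp add: mat_exp_def f_def sums_iff)
  moreover have "complex_of_real (M $ i $ j) = R $ i $ j" for i j
    using sums_unique2[OF sums_of_real[OF fM[of i j]] sums[of i j]] .
  ultimately show ?thesis
    by (simp add: vec_eq_iff flip: R_def)
qed

text \<open>
  As \<open>h\<close> tends to \<open>0\<close>, the difference of two of the exponentials divided by \<open>h\<close> tends to the difference of the exponents,
  which is nonzero. Any \<open>c\<close> below all these finitely many moduli therefore works near \<open>0\<close>.
\<close>

lemma exp_scaled_gap: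
  fixes \<mu> :: "complex^'m"
  assumes inj: "inj (($) \<mu>)"
  obtains c h0 where "0 < c" "0 < h0"
    and "\<And>h k l. \<lbrakk>h \<noteq> 0; \<bar>h\<bar> < h0; k \<noteq> l\<rbrakk> \<Longrightarrow>
           c * \<bar>h\<bar> \<le> cmod (exp (of_real h * \<mu> $ k) - exp (of_real h * \<mu> $ l))"
proof -
  define I where "I = {(k, l). k \<noteq> (l :: 'm)}"
  define D where "D = (\<lambda>(k, l). cmod (\<mu> $ k - \<mu> $ l)) ` I"
  define c where "c = Min (insert 1 D) / 2"
  have pos: "0 < x" if "x \<in> insert 1 D" for x
    using that injD[OF inj] by (auto simp: D_def I_def)
  have fin: "finite (insert 1 D)"
    by (simp add: D_def)
  have c: "0 < c"
    using pos Min_in[OF fin] by (auto simp: c_def)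
  have less: "c < cmod (\<mu> $ k - \<mu> $ l)" if "k \<noteq> l" for k l
  proof -
    have "Min (insert 1 D) \<le> cmod (\<mu> $ k - \<mu> $ l)"
      using that by (intro Min_le fin) (auto simp: D_def I_def)
    with c show ?thesis by (simp add: c_def)
  qed
  define P where "P kl h \<longleftrightarrow> c * \<bar>h\<bar> \<le> cmod (exp (of_real h * \<mu> $ fst kl) - exp (of_real h * \<mu> $ snd kl))"
    for kl and h :: real
  have ev: "\<forall>\<^sub>F h in at 0. P (k, l) h" if "k \<noteq> l" for k l
  proof -
    define f where "f z = exp (z * \<mu> $ k) - exp (z * \<mu> $ l)" for z
    have "(f has_field_derivative \<mu> $ k - \<mu> $ l) (at 0)"
      unfolding f_def by (auto intro!: derivative_eq_intros)
    then have "((\<lambda>z. f z / z) \<longlongrightarrow> \<mu> $ k - \<mu> $ l) (at 0)"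
      using DERIV_D[of f "\<mu> $ k - \<mu> $ l" 0] by (simp add: f_def)
    moreover have "filterlim complex_of_real (at 0) (at 0)"
      unfolding filterlim_at
      by (auto intro!: tendsto_eq_intros simp: eventually_at_filter)
    ultimately have "((\<lambda>h. f (of_real h) / of_real h) \<longlongrightarrow> \<mu> $ k - \<mu> $ l) (at (0::real))"
      by (rule filterlim_compose)
    then have "((\<lambda>h. cmod (f (of_real h) / of_real h)) \<longlongrightarrow> cmod (\<mu> $ k - \<mu> $ l)) (at (0::real))"
      by (rule tendsto_norm)
    then have "\<forall>\<^sub>F h in at 0. c < cmod (f (of_real h) / of_real h)"
      using less[OF that] by (rule order_tendstoD)
    moreover have "\<forall>\<^sub>F h in at 0. h \<noteq> (0::real)"
      by (simp add: eventually_at_filter)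
    ultimately show ?thesis
      by eventually_elim (auto simp: P_def f_def norm_divide field_simps)
  qed
  have "\<forall>\<^sub>F h in at 0. \<forall>kl\<in>I. P kl h"
    using ev by (intro eventually_ball_finite) (auto simp: I_def)
  then obtain h0 where "0 < h0" "\<And>h. \<lbrakk>h \<noteq> 0; \<bar>h\<bar> < h0\<rbrakk> \<Longrightarrow> \<forall>kl\<in>I. P kl h"
    unfolding eventually_at by (auto simp: dist_real_def)
  with c show thesis
    by (intro that[of c h0]) (auto simp: P_def I_def)
qed

section \<open>Rotations in the coordinate planes\<close>

text \<open>
  In each plane \<open>(q\<^sub>j, p\<^sub>j)\<close> this is the matrix with rows \<open>(c\<^sub>j, s\<^sub>j)\<close> and \<open>(- s\<^sub>j, c\<^sub>j)\<close>, so it covers both the generator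
  \<open>J D\<close> of the harmonic oscillators (\<open>c = 0\<close>, \<open>s = \<omega>\<close>) and the rotations that make up its flow.
\<close>

definition plane_maps :: "'a::comm_ring_1^'n \<Rightarrow> 'a^'n \<Rightarrow> 'a^('n + 'n)^('n::finite + 'n)" where
  "plane_maps c s = block_mat (diag_mat c) (diag_mat s) (- diag_mat s) (diag_mat c)"

lemma plane_maps_mult_nth [simp]:
  "(plane_maps c s ** A) $ Inl j $ k = c $ j * A $ Inl j $ k + s $ j * A $ Inr j $ k"
  "(plane_maps c s ** A) $ Inr j $ k = c $ j * A $ Inr j $ k - s $ j * A $ Inl j $ k"
  by (simp_all add: matrix_matrix_mult_def plane_maps_def sum_UNIV_Plus diag_mat_def sum_negf
      if_distrib[of "\<lambda>x. x * _"] cong: if_cong)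

lemma plane_maps_mult_vector_nth [simp]:
  "(plane_maps c s *v z) $ Inl j = c $ j * z $ Inl j + s $ j * z $ Inr j"
  "(plane_maps c s *v z) $ Inr j = c $ j * z $ Inr j - s $ j * z $ Inl j"
  by (simp_all add: matrix_vector_mult_def plane_maps_def sum_UNIV_Plus diag_mat_def sum_negf
      if_distrib[of "\<lambda>x. x * _"] cong: if_cong)

lemma cmat_plane_maps: "cmat (plane_maps c s) = plane_maps (cvec c) (cvec s)"
  by (simp add: vec_eq_iff split_sum_all plane_maps_def diag_mat_def)

lemma plane_maps_one_zero: "plane_maps (\<chi> j. 1) (\<chi> j. 0) = mat 1"
  by (simp add: vec_eq_iff split_sum_all plane_maps_def diag_mat_def mat_def)

lemma J_mat_mult_D_mat: "J_mat ** D_mat \<omega> = plane_maps 0 \<omega>"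
  by (simp add: vec_eq_iff split_sum_all D_mat_def plane_maps_def diag_mat_def)

lemma rotation_sum_squares:
  fixes a b c s :: real
  assumes "c\<^sup>2 + s\<^sup>2 = 1"
  shows "(c * a + s * b)\<^sup>2 + (c * b - s * a)\<^sup>2 = a\<^sup>2 + b\<^sup>2"
proof -
  have "(c * a + s * b)\<^sup>2 + (c * b - s * a)\<^sup>2 = (c\<^sup>2 + s\<^sup>2) * (a\<^sup>2 + b\<^sup>2)"
    by algebra
  with assms show ?thesis by simp
qed

lemma norm_plane_rotations:
  fixes c s :: "real^'n"
  assumes "\<And>j. (c $ j)\<^sup>2 + (s $ j)\<^sup>2 = 1"
  shows "norm (plane_maps c s *v z) = norm z"
  using rotation_sum_squares[OF assms]
  by (simp add: norm_vec_def L2_set_def sum_UNIV_Plus flip: sum.distrib)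

text \<open>
  The columns are the vectors \<open>(e\<^sub>j, \<plusminus> \<i> e\<^sub>j)\<close>, which are eigenvectors of all \<open>plane_maps c s\<close> at once.
\<close>

definition mode_basis :: "complex^('n + 'n)^('n::finite + 'n)" where
  "mode_basis = block_mat (mat 1) (mat 1) (mat \<i>) (mat (- \<i>))"

definition mode_basis_inverse :: "complex^('n + 'n)^('n::finite + 'n)" where
  "mode_basis_inverse = block_mat (mat (1/2)) (mat (- \<i>/2)) (mat (1/2)) (mat (\<i>/2))"

lemma mode_basis_mult_inverse: "mode_basis ** mode_basis_inverse = mat 1"
  by (simp add: vec_eq_iff split_sum_all matrix_matrix_mult_def sum_UNIV_Plus mode_basis_def
      mode_basis_inverse_def mat_def if_distrib[of "\<lambda>x. x * _"] cong: if_cong)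

lemma plane_maps_mult_mode_basis:
  assumes "\<And>j. \<mu> $ Inl j = c $ j + \<i> * s $ j" "\<And>j. \<mu> $ Inr j = c $ j - \<i> * s $ j"
  shows "cmat (plane_maps c s) ** mode_basis = mode_basis ** diag_mat \<mu>"
  unfolding cmat_plane_maps
  by (simp add: vec_eq_iff split_sum_all matrix_mult_diag_mat assms mode_basis_def mat_def algebra_simps)

text \<open>
  In the coordinates \<open>P y\<close> the linear Hamiltonian vector field of \<open>P\<^sup>T D P\<close> is that of \<open>D\<close>, because
  \<open>P\<^sup>T J P = J\<close> amounts to \<open>J P\<^sup>T = P\<^sup>-\<^sup>1 J\<close>.
\<close>

lemma symplectic_conj_J_mat:
  fixes P :: "'a::field^('n + 'n)^('n::finite + 'n)"
  assumes "symplectic P" "P ** Q = mat 1"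
  shows "J_mat ** (transpose P ** D ** P) = Q ** (J_mat ** D) ** P"
proof -
  have "transpose P ** J_mat = transpose P ** J_mat ** (P ** Q)"
    by (simp add: assms)
  also have "\<dots> = J_mat ** Q"
    using assms(1) by (simp add: symplectic_def matrix_mul_assoc)
  finally have "transpose P ** J_mat = J_mat ** Q" .
  then have "J_mat ** (transpose P ** J_mat) ** J_mat = J_mat ** (J_mat ** Q) ** J_mat"
    by simp
  moreover have "J_mat ** (transpose P ** J_mat) ** J_mat = J_mat ** transpose P ** (J_mat ** J_mat)"
    by (simp only: matrix_mul_assoc)
  ultimately have "J_mat ** transpose P = Q ** J_mat"
    by (simp add: J_mat_mult_J_mat J_mat_mult_J_mat_mult matrix_minus_mult matrix_mult_minus)
  then show ?thesis
    by (metis matrix_mul_assoc)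
qed

section \<open>Actions and Hamiltonian near plane rotations\<close>

lemma sum_transpose_mult:
  "(\<Sum>i\<in>UNIV. x $ i * (transpose A *v w) $ i) = (\<Sum>i\<in>UNIV. (A *v x) $ i * w $ i)"
  for A :: "'a::comm_semiring_1^'n^'m"
proof -
  have "(\<Sum>i\<in>UNIV. x $ i * (transpose A *v w) $ i) = (\<Sum>i\<in>UNIV. \<Sum>j\<in>UNIV. A $ j $ i * x $ i * w $ j)"
    by (simp add: matrix_vector_mult_def transpose_def sum_distrib_left mult_ac del: transpose_matrix_vector)
  also have "\<dots> = (\<Sum>j\<in>UNIV. \<Sum>i\<in>UNIV. A $ j $ i * x $ i * w $ j)"
    by (rule sum.swap)
  also have "\<dots> = (\<Sum>i\<in>UNIV. (A *v x) $ i * w $ i)"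
    by (simp add: matrix_vector_mult_def sum_distrib_right)
  finally show ?thesis .
qed

lemma cmat_D_mat_mult_nth [simp]:
  "(cmat (D_mat \<omega>) *v z) $ Inl j = \<omega> $ j * z $ Inl j"
  "(cmat (D_mat \<omega>) *v z) $ Inr j = \<omega> $ j * z $ Inr j"
  by (simp_all add: matrix_vector_mult_def D_mat_def sum_UNIV_Plus diag_mat_def
      if_distrib[of complex_of_real] if_distrib[of "\<lambda>x. x * _"] cong: if_cong)

lemma hamiltonian_eq_sum_actions:
  assumes "H = transpose P ** D_mat \<omega> ** P"
  shows "hamiltonian H y = (\<Sum>j\<in>UNIV. \<omega> $ j * I_action P j y)"
proof -
  define z where "z = cmat P *v y"
  have "cmat H *v y = transpose (cmat P) *v (cmat (D_mat \<omega>) *v z)"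
    by (simp add: assms cmat_mult cmat_transpose z_def matrix_vector_mul_assoc matrix_mul_assoc
        del: transpose_matrix_vector)
  then have "(\<Sum>i\<in>UNIV. y $ i * (cmat H *v y) $ i) = (\<Sum>i\<in>UNIV. z $ i * (cmat (D_mat \<omega>) *v z) $ i)"
    by (simp only: sum_transpose_mult z_def)
  also have "\<dots> = (\<Sum>j\<in>UNIV. \<omega> $ j * (2 * I_action P j y))"
    by (simp add: sum_UNIV_Plus I_action_def J_action_def power2_eq_square algebra_simps
        flip: z_def sum.distrib)
  also have "\<dots> = 2 * (\<Sum>j\<in>UNIV. \<omega> $ j * I_action P j y)"
    by (simp add: sum_distrib_left mult_ac)
  finally show ?thesis
    by (simp add: hamiltonian_def)
qed

lemma J_action_cvec:
  "J_action j (cvec z) = of_real (((z $ Inl j)\<^sup>2 + (z $ Inr j)\<^sup>2) / 2)"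
  by (simp add: J_action_def add.commute)

lemma J_action_perturbed_le:
  "cmod (J_action j (cvec z + f) - J_action j (cvec z)) \<le> 2 * norm z * norm f + (norm f)\<^sup>2"
proof -
  have part: "cmod (2 * of_real (z $ i) * f $ i + (f $ i)\<^sup>2) \<le> 2 * norm z * norm f + (norm f)\<^sup>2" for i
  proof -
    have "cmod (2 * of_real (z $ i) * f $ i + (f $ i)\<^sup>2) \<le> 2 * (\<bar>z $ i\<bar> * cmod (f $ i)) + (cmod (f $ i))\<^sup>2"
      by (rule norm_triangle_le) (simp add: norm_mult norm_power)
    also have "\<dots> \<le> 2 * (norm z * norm f) + (norm f)\<^sup>2"
      using component_le_norm_cart[of z i] Finite_Cartesian_Product.norm_nth_le[of f i]
      by (intro add_mono mult_left_mono mult_mono power_mono) auto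
    finally show ?thesis by simp
  qed
  have "J_action j (cvec z + f) - J_action j (cvec z)
      = (1/2) * ((2 * of_real (z $ Inr j) * f $ Inr j + (f $ Inr j)\<^sup>2)
               + (2 * of_real (z $ Inl j) * f $ Inl j + (f $ Inl j)\<^sup>2))"
    by (simp add: J_action_def power2_eq_square field_simps)
  then have "cmod (J_action j (cvec z + f) - J_action j (cvec z))
      = (1/2) * cmod ((2 * of_real (z $ Inr j) * f $ Inr j + (f $ Inr j)\<^sup>2)
               + (2 * of_real (z $ Inl j) * f $ Inl j + (f $ Inl j)\<^sup>2))"
    by (simp only: norm_mult) simp
  also have "\<dots> \<le> (1/2) * ((2 * norm z * norm f + (norm f)\<^sup>2) + (2 * norm z * norm f + (norm f)\<^sup>2))"
    by (rule mult_left_mono[OF norm_triangle_le[OF add_mono[OF part part]]]) simp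
  finally show ?thesis by simp
qed

lemma norm_Im_vec_le: "norm (Im_vec v) \<le> norm v"
  unfolding norm_vec_def by (rule L2_set_mono) (simp_all add: Im_vec_def abs_Im_le_cmod)

text \<open>
  In the coordinates \<open>P y\<close> the real matrix near \<open>M\<close> acts as a rotation of every plane. It maps real
  vectors to real vectors, preserves the norm of \<open>P y\<close> and preserves every action exactly, so each of
  the quantities below is controlled by the distance \<open>e\<close> of \<open>M\<close> to it.
\<close>

lemma bounds_near_plane_rotations:
  fixes P Q :: "real^('n + 'n)^('n::finite + 'n)" and M :: "complex^('n + 'n)^('n + 'n)"
  assumes PQ: "P ** Q = mat 1" and rot: "\<And>j. (c $ j)\<^sup>2 + (s $ j)\<^sup>2 = 1"
    and near: "norm (M - cmat (Q ** plane_maps c s ** P)) \<le> e"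
  shows "norm (M *v cvec y) \<le> (norm Q * norm P + e) * norm y"
    and "norm (Im_vec (M *v cvec y)) \<le> e * norm y"
    and "cmod (I_action P j (M *v cvec y) - I_action P j (cvec y))
           \<le> (norm P)\<^sup>2 * (2 + e) * e * (norm y)\<^sup>2"
proof -
  define r where "r = plane_maps c s *v (P *v y)"
  define \<delta> where "\<delta> = (M - cmat (Q ** plane_maps c s ** P)) *v cvec y"
  have e: "0 \<le> e"
    using near norm_ge_zero order_trans by blast
  have My: "M *v cvec y = cvec (Q *v r) + \<delta>"
    by (simp add: \<delta>_def r_def matrix_vector_mult_diff_rdistrib cmat_mult_cvec
        matrix_vector_mul_assoc matrix_mul_assoc)
  have "norm \<delta> \<le> norm (M - cmat (Q ** plane_maps c s ** P)) * norm y"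
    using norm_matrix_vector_mult_le[of _ "cvec y"] by (simp add: \<delta>_def norm_cvec)
  also have "\<dots> \<le> e * norm y"
    by (intro mult_right_mono near norm_ge_zero)
  finally have \<delta>: "norm \<delta> \<le> e * norm y" .
  have r: "norm r \<le> norm P * norm y"
    unfolding r_def norm_plane_rotations[OF rot] by (rule norm_matrix_vector_mult_le)
  have "norm (Q *v r) \<le> norm Q * (norm P * norm y)"
    using norm_matrix_vector_mult_le[of Q r] mult_left_mono[OF r norm_ge_zero[of Q]] by linarith
  then show "norm (M *v cvec y) \<le> (norm Q * norm P + e) * norm y"
    using norm_triangle_ineq[of "cvec (Q *v r)" \<delta>] \<delta>
    by (simp add: My norm_cvec algebra_simps)
  have "Im_vec (M *v cvec y) = Im_vec \<delta>"
    by (simp add: My Im_vec_def vec_eq_iff)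
  then show "norm (Im_vec (M *v cvec y)) \<le> e * norm y"
    using norm_Im_vec_le[of \<delta>] \<delta> by simp
  define f where "f = cmat P *v \<delta>"
  have f: "norm f \<le> norm P * (e * norm y)"
    using norm_matrix_vector_mult_le[of "cmat P" \<delta>] mult_left_mono[OF \<delta> norm_ge_zero[of P]]
    by (simp add: f_def norm_cmat)
  have "cmat P *v (M *v cvec y) = cvec r + f"
    using PQ by (simp add: My f_def matrix_vector_right_distrib cmat_mult_cvec matrix_vector_mul_assoc)
  moreover have "J_action j (cvec r) = I_action P j (cvec y)"
    by (simp only: I_action_def cmat_mult_cvec J_action_cvec r_def plane_maps_mult_vector_nth
        rotation_sum_squares[OF rot])
  ultimately have "cmod (I_action P j (M *v cvec y) - I_action P j (cvec y))
      \<le> 2 * norm r * norm f + (norm f)\<^sup>2"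
    using J_action_perturbed_le[of j r f] by (simp add: I_action_def)
  also have "\<dots> \<le> 2 * (norm P * norm y) * (norm P * (e * norm y)) + (norm P * (e * norm y))\<^sup>2"
    using r f by (intro add_mono mult_mono power_mono) auto
  also have "\<dots> = (norm P)\<^sup>2 * (2 + e) * e * (norm y)\<^sup>2"
    by (simp add: power2_eq_square algebra_simps)
  finally show "cmod (I_action P j (M *v cvec y) - I_action P j (cvec y))
           \<le> (norm P)\<^sup>2 * (2 + e) * e * (norm y)\<^sup>2" .
qed

section \<open>Powers of the numerical flow\<close>

lemma smooth_isCont:
  assumes "smooth f"
  shows "isCont f h"
proof -
  obtain D where D: "D 0 = f \<and> (\<forall>k h. (D k has_vector_derivative D (Suc k) h) (at h))"
    using assms unfolding smooth_def ..
  have "(D 0 has_vector_derivative D (Suc 0) h) (at h)"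
    by (rule conjunct2[OF D, THEN spec, THEN spec])
  then have "isCont (D 0) h"
    by (rule has_vector_derivative_continuous)
  then show ?thesis
    by (simp only: D)
qed

lemma tendsto_matrix_mult:
  fixes A :: "'a::real_normed_algebra_1^'n^'m" and B :: "'a^'k^'n"
  assumes "(f \<longlongrightarrow> A) F" "(g \<longlongrightarrow> B) F"
  shows "((\<lambda>h. f h ** g h) \<longlongrightarrow> A ** B) F"
proof (intro vec_tendstoI)
  fix i j
  show "((\<lambda>h. (f h ** g h) $ i $ j) \<longlongrightarrow> (A ** B) $ i $ j) F"
    unfolding matrix_matrix_mult_def vec_lambda_beta
    by (intro tendsto_sum tendsto_mult tendsto_vec_nth assms)
qed

lemma mat_powi_mat_one: "mat_powi (mat 1 :: 'a::semiring_1^'m^'m) n = mat 1"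
proof -
  have "invertible (mat 1 :: 'a^'m^'m)"
    unfolding invertible_def by (rule exI[of _ "mat 1"]) simp
  then have "matrix_inv (mat 1 :: 'a^'m^'m) = mat 1"
    using matrix_inv_mult_left by fastforce
  moreover have "mat_pow (mat 1 :: 'a^'m^'m) k = mat 1" for k
    by (induction k) simp_all
  ultimately show ?thesis
    by (simp add: mat_powi_def)
qed

text \<open>
  In the eigenbasis \<open>V0\<close> of \<open>J H\<close> the matrix \<open>S h\<close> is \<open>diag (exp (h \<nu>\<^sub>k)) + E h\<close> with
  \<open>\<nu>\<^sub>k = \<plusminus> \<i> \<omega>\<^sub>j\<close>. The error \<open>E h\<close> has size \<open>|h|\<^bsup>p+1\<^esup>\<close> and the gap is of order \<open>|h|\<close>, so the quotient
  that governs the distortion of the eigenbasis is of order \<open>|h|\<^sup>p\<close>. The eigenvalues come in conjugate pairs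
  on the unit circle. Their powers, in the unperturbed basis, are rotations of the planes.
\<close>

lemma powers_near_plane_rotations:
  fixes H P Q :: "real^('n::finite + 'n)^('n + 'n)"
    and S :: "real \<Rightarrow> complex^('n + 'n)^('n + 'n)"
  assumes sympl: "\<And>h. symplectic (S h)"
    and "smooth S"
    and closed: "\<And>h. spectrum (S h) = cnj ` spectrum (S h)"
    and p: "p \<ge> 1"
    and approx: "(\<lambda>h. norm (S h - cmat (mat_exp (h *\<^sub>R (J_mat ** H))))) \<in> O[at 0](\<lambda>h. h ^ (p + 1))"
    and "symplectic P" and PQ: "P ** Q = mat 1"
    and H: "H = transpose P ** D_mat \<omega> ** P"
    and inj: "inj (case_sum (\<lambda>i. \<omega> $ i) (\<lambda>i. - (\<omega> $ i)))"
  obtains C h0 where "0 < C" "0 < h0" "h0 \<le> 1"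
    and "\<And>h n. \<bar>h\<bar> < h0 \<Longrightarrow> \<exists>c s. (\<forall>j. (c $ j)\<^sup>2 + (s $ j)\<^sup>2 = 1) \<and>
           norm (mat_powi (S h) n - cmat (Q ** plane_maps c s ** P)) \<le> C * \<bar>h\<bar> ^ p"
proof -
  define freq where "freq = case_sum (\<lambda>i. \<omega> $ i) (\<lambda>i. - (\<omega> $ i))"
  define \<nu> where "\<nu> = (\<chi> k. \<i> * complex_of_real (freq k))"
  define V0 where "V0 = cmat Q ** mode_basis"
  define U0 where "U0 = mode_basis_inverse ** cmat P"
  define m where "m = real CARD('n + 'n)"
  have QP: "Q ** P = mat 1"
    using PQ matrix_left_right_inverse by blast
  have cQP: "cmat Q ** cmat P = mat 1" and cPQ: "cmat P ** cmat Q = mat 1"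
    by (simp_all add: QP PQ cmat_mat_one flip: cmat_mult)
  have "V0 ** U0 = cmat Q ** (mode_basis ** mode_basis_inverse) ** cmat P"
    by (simp add: V0_def U0_def matrix_mul_assoc)
  then have VU: "V0 ** U0 = mat 1"
    by (simp add: mode_basis_mult_inverse cQP)
  have UV: "U0 ** V0 = mat 1"
    using VU matrix_left_right_inverse by blast
  have modes: "cmat (Q ** plane_maps c s ** P) = V0 ** diag_mat \<mu> ** U0"
    if "\<And>j. \<mu> $ Inl j = c $ j + \<i> * s $ j" "\<And>j. \<mu> $ Inr j = c $ j - \<i> * s $ j" for c s \<mu>
  proof -
    have "V0 ** diag_mat \<mu> ** U0 = cmat Q ** (mode_basis ** diag_mat \<mu>) ** mode_basis_inverse ** cmat P"
      by (simp add: V0_def U0_def matrix_mul_assoc)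
    also have "\<dots> = cmat Q ** cmat (plane_maps c s) ** (mode_basis ** mode_basis_inverse) ** cmat P"
      by (simp add: matrix_mul_assoc flip: plane_maps_mult_mode_basis[OF that])
    finally show ?thesis
      by (simp add: mode_basis_mult_inverse cmat_mult)
  qed
  have "cmat (J_mat ** H) = V0 ** diag_mat \<nu> ** U0"
    unfolding H symplectic_conj_J_mat[OF \<open>symplectic P\<close> PQ] J_mat_mult_D_mat
    by (rule modes) (simp_all add: \<nu>_def freq_def)
  then have JH: "cmat (J_mat ** H) ** V0 = V0 ** diag_mat \<nu>"
    by (metis UV matrix_mul_assoc matrix_mul_rid)
  have scale: "cmat (h *\<^sub>R A) ** V0 = h *\<^sub>R (cmat A ** V0)" for h A
    by (simp add: vec_eq_iff matrix_matrix_mult_def scaleR_sum_right) (simp add: scaleR_conv_of_real mult_ac)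
  have "cmat (h *\<^sub>R (J_mat ** H)) ** V0 = V0 ** diag_mat (\<chi> k. of_real h * \<nu> $ k)" for h
    unfolding scale JH by (simp add: vec_eq_iff matrix_mult_diag_mat) (simp add: scaleR_conv_of_real mult_ac)
  note exact = cmat_mat_exp_diagonalised[OF this VU]
  define d where "d h = (\<chi> k. exp (of_real h * \<nu> $ k))" for h :: real
  define E where "E h = U0 ** S h ** V0 - diag_mat (d h)" for h
  have exact': "cmat (mat_exp (h *\<^sub>R (J_mat ** H))) = V0 ** diag_mat (d h) ** U0" for h
    using exact[of h] by (simp add: d_def)
  have E_eq: "E h = U0 ** (S h - cmat (mat_exp (h *\<^sub>R (J_mat ** H)))) ** V0" for h
  proof -
    have "U0 ** (V0 ** diag_mat (d h) ** U0) ** V0 = (U0 ** V0) ** diag_mat (d h) ** (U0 ** V0)"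
      by (simp only: matrix_mul_assoc)
    then show ?thesis
      by (simp add: E_def exact' UV matrix_diff_ldistrib matrix_diff_rdistrib)
  qed
  have SV: "S h ** V0 = V0 ** (diag_mat (d h) + E h)" for h
    by (simp add: E_def matrix_mul_assoc VU)
  obtain K0 where K0: "0 < K0"
    "\<forall>\<^sub>F h in at 0. norm (S h - cmat (mat_exp (h *\<^sub>R (J_mat ** H)))) \<le> K0 * \<bar>h\<bar> ^ (p + 1)"
    using approx by (auto elim!: landau_o.bigE simp: power_abs abs_mult)
  define K where "K = norm U0 * K0 * norm V0 + 1"
  have K: "0 < K"
    using K0(1) by (simp add: K_def add_nonneg_pos)
  have "\<forall>\<^sub>F h in at 0. norm (E h) \<le> K * \<bar>h\<bar> ^ (p + 1)"
    using K0(2)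
  proof eventually_elim
    case (elim h)
    have "norm (E h) \<le> norm U0 * norm (S h - cmat (mat_exp (h *\<^sub>R (J_mat ** H)))) * norm V0"
      unfolding E_eq by (rule norm_matrix_mult3_le)
    also have "\<dots> \<le> norm U0 * (K0 * \<bar>h\<bar> ^ (p + 1)) * norm V0"
      by (intro mult_left_mono mult_right_mono elim norm_ge_zero)
    also have "\<dots> \<le> K * \<bar>h\<bar> ^ (p + 1)"
      by (simp add: K_def algebra_simps)
    finally show ?case .
  qed
  then obtain h1 where h1: "0 < h1" "\<And>h. \<lbrakk>h \<noteq> 0; \<bar>h\<bar> < h1\<rbrakk> \<Longrightarrow> norm (E h) \<le> K * \<bar>h\<bar> ^ (p + 1)"
    unfolding eventually_at by (auto simp: dist_real_def)
  \<comment> \<open>The consistency estimate says nothing about the value at 0; continuity recovers it.\<close>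
  have S0: "S 0 = mat 1"
  proof -
    have "(S \<longlongrightarrow> S 0) (at 0)"
      using smooth_isCont[OF \<open>smooth S\<close>] isContD by blast
    moreover have "((\<lambda>h. diag_mat (d h)) \<longlongrightarrow> mat 1) (at 0)"
    proof (intro vec_tendstoI)
      fix i j
      have "((\<lambda>h. exp (of_real h * \<nu> $ i)) \<longlongrightarrow> exp (of_real 0 * \<nu> $ i)) (at (0::real))"
        by (intro tendsto_intros)
      then show "((\<lambda>h. diag_mat (d h) $ i $ j) \<longlongrightarrow> mat 1 $ i $ j) (at 0)"
        by (auto simp: diag_mat_def mat_def d_def)
    qed
    ultimately have "(E \<longlongrightarrow> U0 ** S 0 ** V0 - mat 1) (at 0)"
      unfolding E_def by (intro tendsto_diff tendsto_matrix_mult tendsto_const)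
    moreover have "(E \<longlongrightarrow> 0) (at 0)"
    proof (rule Lim_null_comparison[OF \<open>\<forall>\<^sub>F h in at 0. norm (E h) \<le> K * \<bar>h\<bar> ^ (p + 1)\<close>])
      have "((\<lambda>h. K * \<bar>h\<bar> ^ (p + 1)) \<longlongrightarrow> K * \<bar>0::real\<bar> ^ (p + 1)) (at 0)"
        by (intro tendsto_intros)
      then show "((\<lambda>h::real. K * \<bar>h\<bar> ^ (p + 1)) \<longlongrightarrow> 0) (at 0)" by simp
    qed
    ultimately have "U0 ** S 0 ** V0 - mat 1 = 0"
      using LIM_unique by blast
    then have "V0 ** (U0 ** S 0 ** V0) ** U0 = V0 ** U0"
      by simp
    moreover have "V0 ** (U0 ** S 0 ** V0) ** U0 = (V0 ** U0) ** S 0 ** (V0 ** U0)"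
      by (simp only: matrix_mul_assoc)
    ultimately show ?thesis
      by (simp add: VU)
  qed
  have freq: "inj freq"
    using inj by (simp add: freq_def)
  have "inj (($) \<nu>)"
  proof (rule injI)
    fix k l assume "\<nu> $ k = \<nu> $ l"
    then have "freq k = freq l"
      by (simp add: \<nu>_def)
    then show "k = l"
      by (rule injD[OF freq])
  qed
  then obtain g h2 where g: "0 < g" and h2: "0 < h2"
    and gap: "\<And>h k l. \<lbrakk>h \<noteq> 0; \<bar>h\<bar> < h2; k \<noteq> l\<rbrakk> \<Longrightarrow> g * \<bar>h\<bar> \<le> cmod (d h $ k - d h $ l)"
    unfolding d_def by (rule exp_scaled_gap) auto
  define swap where "swap = case_sum Inr (Inl :: 'n \<Rightarrow> 'n + 'n)"
  have d1: "cmod (d h $ k) = 1" for h k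
    by (simp add: d_def \<nu>_def)
  have freq_swap: "freq (swap k) = - freq k" for k
    by (cases k) (simp_all add: freq_def swap_def)
  have conj: "d h $ swap k = cnj (d h $ k)" for h k
    by (simp add: d_def \<nu>_def freq_swap exp_cnj)
  define C where "C = norm V0 * norm U0 * (16 * m ^ 4 * (K / g)) + 1"
  have C: "0 < C"
    using K g by (simp add: C_def m_def add_nonneg_pos)
  have m: "0 < m"
    unfolding m_def by simp
  \<comment> \<open>The last two terms keep \<open>E h\<close> small relative to the gap and in absolute size.\<close>
  define h0 where "h0 = Min {1, h1, h2, g / (8 * m\<^sup>2 * K), 1 / (4 * K)}"
  have h0: "0 < h0" "h0 \<le> 1"
    using h1 h2 g K m by (auto simp: h0_def)
  have "\<exists>c s. (\<forall>j. (c $ j)\<^sup>2 + (s $ j)\<^sup>2 = 1) \<and>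
           norm (mat_powi (S h) n - cmat (Q ** plane_maps c s ** P)) \<le> C * \<bar>h\<bar> ^ p"
    if "\<bar>h\<bar> < h0" for h n
  proof (cases "h = 0")
    case True
    have "mat_powi (S h) n = cmat (Q ** plane_maps (\<chi> j. 1) (\<chi> j. 0) ** P)"
      by (simp add: True S0 mat_powi_mat_one plane_maps_one_zero QP cmat_mat_one)
    then show ?thesis
      using C by (intro exI[of _ "\<chi> j. 1"] exI[of _ "\<chi> j. 0"]) simp
  next
    case False
    have hs: "\<bar>h\<bar> < 1" "\<bar>h\<bar> < h1" "\<bar>h\<bar> < h2" "\<bar>h\<bar> < g / (8 * m\<^sup>2 * K)" "\<bar>h\<bar> < 1 / (4 * K)"
      using that by (simp_all add: h0_def)
    have hp: "\<bar>h\<bar> ^ p \<le> \<bar>h\<bar>"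
      using hs(1) p power_decreasing[of 1 p "\<bar>h\<bar>"] by simp
    have E: "norm (E h) \<le> K * \<bar>h\<bar> ^ p * \<bar>h\<bar>"
      using h1(2)[OF False hs(2)] by (simp add: mult_ac)
    have "8 * m\<^sup>2 * (K * \<bar>h\<bar> ^ p) \<le> 8 * m\<^sup>2 * (K * \<bar>h\<bar>)"
      using K hp by (intro mult_left_mono) auto
    also have "\<dots> \<le> g"
      using hs(4) K m by (simp add: field_simps)
    finally have "8 * m\<^sup>2 * (K * \<bar>h\<bar> ^ p) * \<bar>h\<bar> \<le> g * \<bar>h\<bar>"
      by (intro mult_right_mono) auto
    moreover have "8 * m\<^sup>2 * norm (E h) \<le> 8 * m\<^sup>2 * (K * \<bar>h\<bar> ^ p * \<bar>h\<bar>)"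
      using E by (intro mult_left_mono) auto
    ultimately have small1: "8 * m\<^sup>2 * norm (E h) \<le> g * \<bar>h\<bar>"
      by (simp add: mult_ac)
    have "\<bar>h\<bar> ^ p * \<bar>h\<bar> \<le> \<bar>h\<bar> * 1"
      using hp hs(1) by (intro mult_mono) auto
    then have "K * (\<bar>h\<bar> ^ p * \<bar>h\<bar>) \<le> K * \<bar>h\<bar>"
      using K by simp
    also have "\<dots> \<le> 1/4"
      using hs(5) K by (simp add: field_simps)
    finally have small2: "norm (E h) \<le> 1/4"
      using E by (simp add: mult_ac)
    have gap_h: "g * \<bar>h\<bar> \<le> cmod (d h $ k - d h $ l)" if "k \<noteq> l" for k l
      by (rule gap[OF False hs(3) that])
    have gh: "0 < g * \<bar>h\<bar>"
      using g False by simp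
    obtain \<mu> where \<mu>: "\<And>k. cmod (\<mu> $ k) = 1" "\<And>k. \<mu> $ swap k = cnj (\<mu> $ k)"
      and near: "\<And>n. norm (mat_powi (S h) n - V0 ** diag_mat (\<chi> k. \<mu> $ k powi n) ** U0)
               \<le> norm V0 * norm U0 * (16 * m ^ 4 * (norm (E h) / (g * \<bar>h\<bar>)))"
      by (rule symplectic_powers_near_diagonal[OF sympl closed SV VU gap_h gh d1 conj
          small1[unfolded m_def] small2, folded m_def]) (assumption, rule that)
    \<comment> \<open>Up to orientation, plane \<open>j\<close> turns by the argument of the power of its eigenvalue.\<close>
    define c where "c = (\<chi> j. Re (\<mu> $ Inl j powi n))"
    define s where "s = (\<chi> j. Im (\<mu> $ Inl j powi n))"
    have "\<forall>j. (c $ j)\<^sup>2 + (s $ j)\<^sup>2 = 1"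
      using \<mu>(1) by (simp add: c_def s_def norm_power_int flip: cmod_power2)
    moreover have "norm (mat_powi (S h) n - cmat (Q ** plane_maps c s ** P)) \<le> C * \<bar>h\<bar> ^ p"
    proof -
      have Inl: "\<mu> $ Inl j powi n = c $ j + \<i> * s $ j" for j
        by (simp add: c_def s_def complex_eq_iff)
      have "\<mu> $ Inr j powi n = cnj (\<mu> $ Inl j powi n)" for j
        using \<mu>(2)[of "Inl j"] by (simp add: swap_def)
      then have "\<mu> $ Inr j powi n = c $ j - \<i> * s $ j" for j
        unfolding Inl by simp
      with Inl have eq: "cmat (Q ** plane_maps c s ** P) = V0 ** diag_mat (\<chi> k. \<mu> $ k powi n) ** U0"
        by (intro modes) simp_all
      have "norm (E h) / (g * \<bar>h\<bar>) \<le> K / g * \<bar>h\<bar> ^ p"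
        using E g False by (simp add: field_simps)
      then have "norm V0 * norm U0 * (16 * m ^ 4 * (norm (E h) / (g * \<bar>h\<bar>)))
          \<le> norm V0 * norm U0 * (16 * m ^ 4 * (K / g * \<bar>h\<bar> ^ p))"
        using m by (intro mult_left_mono) auto
      moreover have "\<dots> \<le> C * \<bar>h\<bar> ^ p"
        by (simp add: C_def algebra_simps)
      ultimately show ?thesis
        using near[of n] unfolding eq by linarith
    qed
    ultimately show ?thesis
      by (intro exI[of _ c] exI[of _ s] conjI)
  qed
  with C h0 show thesis
    by (rule that)
qed

theorem corollary4p2:
  fixes H P :: "real^('n::finite + 'n)^('n + 'n)"
    and S :: "real \<Rightarrow> complex^('n + 'n)^('n + 'n)"
    and \<omega> :: "real^'n"
    and p :: nat
  assumes "transpose H = H"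
    and "\<And>h. symplectic (S h)"
    and "smooth S"
    and "\<And>h. spectrum (S h) = cnj ` spectrum (S h)"
    and "p \<ge> 1"
    and "(\<lambda>h. norm (S h - cmat (mat_exp (h *\<^sub>R (J_mat ** H))))) \<in> O[at 0](\<lambda>h. h ^ (p + 1))"
    and "symplectic P"
    and "H = transpose P ** D_mat \<omega> ** P"
    and "inj (case_sum (\<lambda>i. \<omega> $ i) (\<lambda>i. - (\<omega> $ i)))"
  shows "\<exists>C>0. \<exists>h0>0. \<forall>h. \<bar>h\<bar> < h0 \<longrightarrow> (\<forall>y :: real^('n + 'n).
      (SUP n::int. ereal (norm (mat_powi (S h) n *v cvec y))) \<le> ereal (C * norm y) \<and>
      (SUP n::int. ereal (norm (Im_vec (mat_powi (S h) n *v cvec y))))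
        \<le> ereal (C * \<bar>h\<bar> ^ p * norm y) \<and>
      (SUP n::int. SUP j::'n.
          ereal (cmod (I_action P j (mat_powi (S h) n *v cvec y) - I_action P j (cvec y))))
        \<le> ereal (C * \<bar>h\<bar> ^ p * (norm y)\<^sup>2) \<and>
      (SUP n::int.
          ereal (cmod (hamiltonian H (mat_powi (S h) n *v cvec y) - hamiltonian H (cvec y))))
        \<le> ereal (C * \<bar>h\<bar> ^ p * (norm y)\<^sup>2))"
proof -
  obtain Q where "Q ** P = mat 1"
    using symplectic_left_inverse[OF \<open>symplectic P\<close>] by blast
  then have PQ: "P ** Q = mat 1"
    using matrix_left_right_inverse by blast
  obtain B h0 where B: "0 < B" and h0: "0 < h0" "h0 \<le> 1"
    and near: "\<And>h n. \<bar>h\<bar> < h0 \<Longrightarrow> \<exists>c s. (\<forall>j. (c $ j)\<^sup>2 + (s $ j)\<^sup>2 = 1) \<and>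
           norm (mat_powi (S h) n - cmat (Q ** plane_maps c s ** P)) \<le> B * \<bar>h\<bar> ^ p"
    by (rule powers_near_plane_rotations[OF assms(2-7) PQ assms(8,9)]) (rule that)
  define a where "a = (norm P)\<^sup>2 * (2 + B) * B"
  define w where "w = (\<Sum>j\<in>UNIV. \<bar>\<omega> $ j\<bar>)"
  define C where "C = norm Q * norm P + B + a + w * a"
  have a: "0 \<le> a" and w: "0 \<le> w"
    using B by (simp_all add: a_def w_def sum_nonneg)
  have C: "0 < C" "norm Q * norm P + B \<le> C" "B \<le> C" "a \<le> C" "w * a \<le> C"
    using B a w mult_nonneg_nonneg[OF w a] mult_nonneg_nonneg[OF norm_ge_zero[of Q] norm_ge_zero[of P]]
    unfolding C_def by linarith+
  have bounds: "norm (mat_powi (S h) n *v cvec y) \<le> C * norm y \<and>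
      norm (Im_vec (mat_powi (S h) n *v cvec y)) \<le> C * \<bar>h\<bar> ^ p * norm y \<and>
      (\<forall>j. cmod (I_action P j (mat_powi (S h) n *v cvec y) - I_action P j (cvec y))
         \<le> C * \<bar>h\<bar> ^ p * (norm y)\<^sup>2) \<and>
      cmod (hamiltonian H (mat_powi (S h) n *v cvec y) - hamiltonian H (cvec y))
         \<le> C * \<bar>h\<bar> ^ p * (norm y)\<^sup>2" if h: "\<bar>h\<bar> < h0" for h n y
  proof -
    define z where "z = mat_powi (S h) n *v cvec y"
    obtain c s where rot: "\<And>j. (c $ j)\<^sup>2 + (s $ j)\<^sup>2 = 1"
      and M: "norm (mat_powi (S h) n - cmat (Q ** plane_maps c s ** P)) \<le> B * \<bar>h\<bar> ^ p"
      using near[OF h] by blast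
    note est = bounds_near_plane_rotations[OF PQ rot M, where y = y, folded z_def]
    have hp: "\<bar>h\<bar> ^ p \<le> 1"
      using h h0 by (intro power_le_one) auto
    then have Bh: "B * \<bar>h\<bar> ^ p \<le> B"
      using B by simp
    have 1: "norm z \<le> C * norm y"
    proof -
      have "(norm Q * norm P + B * \<bar>h\<bar> ^ p) * norm y \<le> C * norm y"
        using Bh C(2) by (intro mult_right_mono) auto
      with est(1) show ?thesis by linarith
    qed
    have 2: "norm (Im_vec z) \<le> C * \<bar>h\<bar> ^ p * norm y"
    proof -
      have "B * \<bar>h\<bar> ^ p * norm y \<le> C * \<bar>h\<bar> ^ p * norm y"
        using C(3) by (intro mult_right_mono) auto
      with est(2) show ?thesis by linarith
    qed
    have act: "cmod (I_action P j z - I_action P j (cvec y)) \<le> a * (\<bar>h\<bar> ^ p * (norm y)\<^sup>2)" for j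
    proof -
      have "(norm P)\<^sup>2 * (2 + B * \<bar>h\<bar> ^ p) * (B * \<bar>h\<bar> ^ p) * (norm y)\<^sup>2
          \<le> (norm P)\<^sup>2 * (2 + B) * (B * \<bar>h\<bar> ^ p) * (norm y)\<^sup>2"
        using Bh B by (intro mult_right_mono mult_left_mono) auto
      with est(3)[of j] show ?thesis
        by (simp add: a_def mult_ac)
    qed
    have 3: "cmod (I_action P j z - I_action P j (cvec y)) \<le> C * \<bar>h\<bar> ^ p * (norm y)\<^sup>2" for j
    proof -
      have "a * (\<bar>h\<bar> ^ p * (norm y)\<^sup>2) \<le> C * (\<bar>h\<bar> ^ p * (norm y)\<^sup>2)"
        using C(4) by (intro mult_right_mono) auto
      with act[of j] show ?thesis by (simp add: mult_ac)
    qed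
    have 4: "cmod (hamiltonian H z - hamiltonian H (cvec y)) \<le> C * \<bar>h\<bar> ^ p * (norm y)\<^sup>2"
    proof -
      have "hamiltonian H z - hamiltonian H (cvec y)
          = (\<Sum>j\<in>UNIV. \<omega> $ j * (I_action P j z - I_action P j (cvec y)))"
        by (simp add: hamiltonian_eq_sum_actions[OF assms(8)] right_diff_distrib sum_subtractf)
      then have "cmod (hamiltonian H z - hamiltonian H (cvec y))
          \<le> (\<Sum>j\<in>UNIV. \<bar>\<omega> $ j\<bar> * cmod (I_action P j z - I_action P j (cvec y)))"
        by (simp add: norm_mult sum_norm_le)
      also have "\<dots> \<le> (\<Sum>j\<in>UNIV. \<bar>\<omega> $ j\<bar> * (a * (\<bar>h\<bar> ^ p * (norm y)\<^sup>2)))"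
        by (intro sum_mono mult_left_mono act) auto
      also have "\<dots> = w * a * (\<bar>h\<bar> ^ p * (norm y)\<^sup>2)"
        unfolding w_def sum_distrib_right by (simp only: mult.assoc)
      also have "\<dots> \<le> C * (\<bar>h\<bar> ^ p * (norm y)\<^sup>2)"
        using C(5) by (intro mult_right_mono) auto
      finally show ?thesis by (simp add: mult_ac)
    qed
    show ?thesis
      using 1 2 3 4 by (simp add: z_def)
  qed
  show ?thesis
  proof (rule exI[of _ C], rule conjI[OF C(1)], rule exI[of _ h0], rule conjI[OF h0(1)],
      intro allI impI conjI)
    fix h :: real and y :: "real^('n + 'n)"
    assume h: "\<bar>h\<bar> < h0"
    note b = bounds[OF h, where y = y]
    show "(SUP n::int. ereal (norm (mat_powi (S h) n *v cvec y))) \<le> ereal (C * norm y)"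
      by (rule SUP_least) (use b in simp)
    show "(SUP n::int. ereal (norm (Im_vec (mat_powi (S h) n *v cvec y))))
        \<le> ereal (C * \<bar>h\<bar> ^ p * norm y)"
      by (rule SUP_least) (use b in simp)
    show "(SUP n::int. SUP j::'n.
          ereal (cmod (I_action P j (mat_powi (S h) n *v cvec y) - I_action P j (cvec y))))
        \<le> ereal (C * \<bar>h\<bar> ^ p * (norm y)\<^sup>2)"
      by (rule SUP_least, rule SUP_least) (use b in simp)
    show "(SUP n::int.
          ereal (cmod (hamiltonian H (mat_powi (S h) n *v cvec y) - hamiltonian H (cvec y))))
        \<le> ereal (C * \<bar>h\<bar> ^ p * (norm y)\<^sup>2)"
      by (rule SUP_least) (use b in simp)
  qed
qed

end
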